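(* Let $\mathcal S\subseteq M_n$ and $\mathcal T\subseteq M_m$ be noncommutative graphs. The following are equivalent: (i) $\mathcal S\sim_{\mathrm{TRO}}\mathcal T$. (ii) There exists a unital completely positive map $\varphi\colon M_m\to M_n$ such that $$\mathcal S=\mathcal T^{\leftarrow\varphi}\qquad\text{and}\qquad \mathcal T=\mathcal S^{\rightarrow\varphi}.$$
   Context: $M_n$ denotes the complex $n\times n$ matrices and $M_{m,n}$ the complex $m\times n$ matrices. A noncommutative graph in $M_n$ is an operator system $\mathcal S\subseteq M_n$, i.e. a selfadjoint linear subspace containing the identity (viewed as a quantum graph on the algebra $M_n$, whose commutant is $\mathbb C I_n$). $[\,\cdot\,]$ denotes linear span. A TRO is a subspace $\mathcal M\subseteq M_{m,n}$ with $\mathcal M\mathcal M^*\mathcal M\subseteq\mathcal M$; it is non-degenerate if $I_n\in[\mathcal M^*\mathcal M]$ and $I_m\in[\mathcal M\mathcal M^*]$. $\mathcal S\sim_{\mathrm{TRO}}\mathcal T$ means that there is a non-degenerate TRO $\mathcal M\subseteq M_{m,n}$ such that $x^*ty\in\mathcal S$ and $xsy^*\in\mathcal T$ for all $x,y\in\mathcal M$, $s\in\mathcal S$, $t\in\mathcal T$. For a unital completely positive map $\varphi\colon M_m\to M_n$ with Kraus representation $\varphi(b)=\sum_{i=1}^rv_i^*bv_i$, $v_i\in M_{m,n}$, set $$\mathcal S^{\rightarrow\varphi}=\operatorname{span}\{v_isv_j^*: s\in\mathcal S,\ i,j\in\{1,\dots,r\}\}\subseteq M_m,\qquad \mathcal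 T^{\leftarrow\varphi}=\operatorname{span}\{v_i^*tv_j: t\in\mathcal T,\ i,j\in\{1,\dots,r\}\}\subseteq M_n.$$ These do not depend on the Kraus representation. *)

theory Defs
  imports "HOL-Analysis.Analysis"
begin

text \<open>
  Complex matrices with \<open>m\<close> rows and \<open>n\<close> columns are elements of \<open>complex^'n^'m\<close>. On
  this type the overloaded \<open>span\<close> is the real span, and the scalars of \<open>*s\<close> are vectors
  (multiplied componentwise), so the complex vector space structure is introduced here.
\<close>

definition cmat_scale :: "complex \<Rightarrow> complex^'n^'m \<Rightarrow> complex^'n^'m" where
  "cmat_scale c A = (\<chi> i j. c * A $ i $ j)"

interpretation cmat: vector_space "cmat_scale :: complex \<Rightarrow> complex^'n^'m \<Rightarrow> complex^'n^'m"
  by unfold_locales (simp_all add: cmat_scale_def vec_eq_iff algebra_simps)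

definition cmat_adj :: "complex^'n^'m \<Rightarrow> complex^'m^'n" where
  "cmat_adj A = (\<chi> i j. cnj (A $ j $ i))"

definition nc_graph :: "(complex^'n^'n) set \<Rightarrow> bool" where
  "nc_graph S \<longleftrightarrow> cmat.subspace S \<and> (\<forall>a\<in>S. cmat_adj a \<in> S) \<and> mat 1 \<in> S"

definition TRO :: "(complex^'n^'m) set \<Rightarrow> bool" where
  "TRO M \<longleftrightarrow> cmat.subspace M \<and>
     (\<forall>x\<in>M. \<forall>y\<in>M. \<forall>z\<in>M. x ** cmat_adj y ** z \<in> M)"

definition nondegenerate :: "(complex^'n^'m) set \<Rightarrow> bool" where
  "nondegenerate M \<longleftrightarrow>
     mat 1 \<in> cmat.span {cmat_adj x ** y | x y. x \<in> M \<and> y \<in> M} \<and>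
     mat 1 \<in> cmat.span {x ** cmat_adj y | x y. x \<in> M \<and> y \<in> M}"

definition TRO_equivalent :: "(complex^'n^'n) set \<Rightarrow> (complex^'m^'m) set \<Rightarrow> bool" where
  "TRO_equivalent S T \<longleftrightarrow>
     (\<exists>M :: (complex^'n^'m) set. TRO M \<and> nondegenerate M \<and>
        (\<forall>x\<in>M. \<forall>y\<in>M. \<forall>t\<in>T. cmat_adj x ** t ** y \<in> S) \<and>
        (\<forall>x\<in>M. \<forall>y\<in>M. \<forall>s\<in>S. x ** s ** cmat_adj y \<in> T))"

text \<open>
  An element of \<open>M\<^sub>k(M\<^sub>m)\<close> is given by its blocks \<open>B i j\<close> with \<open>i, j < k\<close>; blocks with larger
  indices are ignored. It is positive if it is positive semidefinite as an operator on
  the direct sum of \<open>k\<close> copies of \<open>complex^'m\<close>. Membership in \<open>\<real>\<^sub>\<ge>\<^sub>0\<close> says that the quadratic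
  form is real and nonnegative, which over the complex numbers includes selfadjointness.
\<close>

definition block_positive :: "nat \<Rightarrow> (nat \<Rightarrow> nat \<Rightarrow> complex^'m^'m) \<Rightarrow> bool" where
  "block_positive k B \<longleftrightarrow>
     (\<forall>\<xi> :: nat \<Rightarrow> complex^'m.
        (\<Sum>i<k. \<Sum>j<k. \<Sum>a\<in>UNIV. cnj (\<xi> i $ a) * (B i j *v \<xi> j) $ a) \<in> \<real>\<^sub>\<ge>\<^sub>0)"

definition completely_positive :: "(complex^'m^'m \<Rightarrow> complex^'n^'n) \<Rightarrow> bool" where
  "completely_positive \<phi> \<longleftrightarrow>
     Vector_Spaces.linear cmat_scale cmat_scale \<phi> \<and>
     (\<forall>k B. block_positive k B \<longrightarrow> block_positive k (\<lambda>i j. \<phi> (B i j)))"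

definition ucp :: "(complex^'m^'m \<Rightarrow> complex^'n^'n) \<Rightarrow> bool" where
  "ucp \<phi> \<longleftrightarrow> completely_positive \<phi> \<and> \<phi> (mat 1) = mat 1"

definition kraus_representation ::
    "(complex^'m^'m \<Rightarrow> complex^'n^'n) \<Rightarrow> (complex^'n^'m) list \<Rightarrow> bool" where
  "kraus_representation \<phi> vs \<longleftrightarrow> (\<forall>b. \<phi> b = (\<Sum>v\<leftarrow>vs. cmat_adj v ** b ** v))"

text \<open>
  Every completely positive map has a Kraus representation (Choi), and the linear span of
  the Kraus operators does not depend on it. Hence the two sets below do not depend on
  the choice made here either, provided \<open>\<phi>\<close> is completely positive.
\<close>

definition kraus_ops :: "(complex^'m^'m \<Rightarrow> complex^'n^'n) \<Rightarrow> (complex^'n^'m) list" where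
  "kraus_ops \<phi> = (SOME vs. kraus_representation \<phi> vs)"

definition pushforward ::
    "(complex^'n^'n) set \<Rightarrow> (complex^'m^'m \<Rightarrow> complex^'n^'n) \<Rightarrow> (complex^'m^'m) set" where
  "pushforward S \<phi> = cmat.span
     {v ** s ** cmat_adj w | v s w. s \<in> S \<and> v \<in> set (kraus_ops \<phi>) \<and> w \<in> set (kraus_ops \<phi>)}"

definition pullback ::
    "(complex^'m^'m) set \<Rightarrow> (complex^'m^'m \<Rightarrow> complex^'n^'n) \<Rightarrow> (complex^'n^'n) set" where
  "pullback T \<phi> = cmat.span
     {cmat_adj v ** t ** w | v t w. t \<in> T \<and> v \<in> set (kraus_ops \<phi>) \<and> w \<in> set (kraus_ops \<phi>)}"

end

theory Submission
  imports Defs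
begin

text \<open>
  Given a TRO \<open>M\<close> implementing the equivalence, take a spanning list \<open>v\<^sub>i\<close>; then \<open>a = \<Sum> v\<^sub>i\<^sup>* v\<^sub>i\<close> is an invertible
  positive element of the algebra \<open>[M\<^sup>* M]\<close>, and the \<open>v\<^sub>i a\<^sup>-\<^sup>1\<^sup>/\<^sup>2\<close> still span \<open>M\<close> and are the
  Kraus operators of a unital map. Conversely, \<open>M\<close> is the TRO generated by the Kraus
  operators \<open>v\<^sub>i\<close>. Products of odd length \<open>x = v\<^sub>1 v\<^sub>2\<^sup>* v\<^sub>3 \<dots>\<close> inherit \<open>x\<^sup>* T y \<subseteq> S\<close> and
  \<open>x S y\<^sup>* \<subseteq> T\<close> for \<open>x\<close> and \<open>y\<close> of equal length, and \<open>\<Sum> v\<^sub>i\<^sup>* v\<^sub>i = 1\<close> reduces unequal lengths to this case.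
  Non-degeneracy on the left holds because \<open>\<Sum> v\<^sub>i v\<^sub>i\<^sup>*\<close> is injective, which follows from \<open>1 \<in> T = [v\<^sub>i S v\<^sub>j\<^sup>*]\<close>.
\<close>

section \<open>Matrices, spans and Gram matrices\<close>

lemma matrix_mult_zero [simp]:
  "(0 :: complex^'n^'m) ** (A :: complex^'k^'n) = 0" "B ** (0 :: complex^'n^'m) = (0 :: complex^'n^'k)"
  by (simp_all add: matrix_matrix_mult_def vec_eq_iff)

lemma matrix_add_rdistrib: "(A + B) ** C = A ** C + B ** (C :: complex^'n^'m)"
  by (simp add: matrix_matrix_mult_def vec_eq_iff sum.distrib distrib_right)

lemma cmat_scale_mult:
  "cmat_scale c A ** B = cmat_scale c (A ** B)"
  "A ** cmat_scale c B = cmat_scale c (A ** B)"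
  by (simp_all add: cmat_scale_def matrix_matrix_mult_def vec_eq_iff sum_distrib_left mult_ac)

lemma cmat_scale_mult_vector: "cmat_scale c A *v x = c *s (A *v x)"
  by (simp add: cmat_scale_def matrix_vector_mult_def vec_eq_iff sum_distrib_left mult_ac)

lemma scaleR_eq_cmat_scale: "r *\<^sub>R A = cmat_scale (of_real r) A"
  by (simp add: cmat_scale_def vec_eq_iff complex_eq_iff)

lemma cmat_adj_adj [simp]: "cmat_adj (cmat_adj A) = A"
  by (simp add: cmat_adj_def vec_eq_iff)

lemma cmat_adj_add [simp]: "cmat_adj (A + B) = cmat_adj A + cmat_adj B"
  by (simp add: cmat_adj_def vec_eq_iff)

lemma cmat_adj_diff [simp]: "cmat_adj (A - B) = cmat_adj A - cmat_adj B"
  by (simp add: cmat_adj_def vec_eq_iff)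

lemma cmat_adj_0 [simp]: "cmat_adj 0 = 0"
  by (simp add: cmat_adj_def vec_eq_iff)

lemma cmat_adj_scale [simp]: "cmat_adj (cmat_scale c A) = cmat_scale (cnj c) (cmat_adj A)"
  by (simp add: cmat_adj_def cmat_scale_def vec_eq_iff)

lemma cmat_adj_scaleR [simp]: "cmat_adj (r *\<^sub>R A) = r *\<^sub>R cmat_adj A"
  by (simp add: scaleR_eq_cmat_scale)

lemma cmat_adj_mat_1 [simp]: "cmat_adj (mat 1) = mat 1"
  by (simp add: cmat_adj_def mat_def vec_eq_iff)

lemma cmat_adj_mult [simp]: "cmat_adj (A ** B) = cmat_adj B ** cmat_adj A"
  by (simp add: cmat_adj_def matrix_matrix_mult_def vec_eq_iff mult.commute)

lemma sum_cnj_mult_cmat_adj: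
  fixes A :: "complex^'n^'m"
  shows "(\<Sum>i\<in>UNIV. cnj (x$i) * (cmat_adj A *v y)$i) = (\<Sum>i\<in>UNIV. cnj ((A *v x)$i) * y$i)"
proof -
  have "(\<Sum>i\<in>UNIV. cnj (x$i) * (cmat_adj A *v y)$i)
      = (\<Sum>j\<in>UNIV. \<Sum>i\<in>UNIV. cnj (A$i$j * x$j) * y$i)"
    by (simp add: matrix_vector_mult_def cmat_adj_def sum_distrib_left mult_ac)
  also have "\<dots> = (\<Sum>i\<in>UNIV. \<Sum>j\<in>UNIV. cnj (A$i$j * x$j) * y$i)"
    by (rule sum.swap)
  also have "\<dots> = (\<Sum>i\<in>UNIV. cnj ((A *v x)$i) * y$i)"
    by (simp add: matrix_vector_mult_def sum_distrib_right)
  finally show ?thesis .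
qed

lemma inner_cmat_adj:
  fixes A :: "complex^'n^'m"
  shows "(A *v x) \<bullet> y = x \<bullet> (cmat_adj A *v y)"
proof -
  have inner_vec: "u \<bullet> v = Re (\<Sum>i\<in>UNIV. cnj (u$i) * v$i)" for u v :: "complex^'k"
    by (simp add: inner_vec_def inner_complex_def)
  show ?thesis
    by (simp only: inner_vec sum_cnj_mult_cmat_adj)
qed

lemma sum_list_mult_left: "A ** (\<Sum>v\<leftarrow>vs. f v) = (\<Sum>v\<leftarrow>vs. A ** (f v :: complex^'n^'m))"
  by (induction vs) (simp_all add: matrix_add_ldistrib)

lemma sum_list_mult_right: "(\<Sum>v\<leftarrow>vs. f v) ** A = (\<Sum>v\<leftarrow>vs. (f v :: complex^'n^'m) ** A)"
  by (induction vs) (simp_all add: matrix_add_rdistrib)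

section \<open>Complex subspaces and membership conditions on spans\<close>

lemma subspace_sum_list:
  assumes "cmat.subspace W" "\<And>v. v \<in> set vs \<Longrightarrow> f v \<in> W"
  shows "(\<Sum>v\<leftarrow>vs. f v) \<in> W"
  using assms(2) by (induction vs) (auto intro: cmat.subspace_add assms(1) cmat.subspace_0)

text \<open>Gives access to the results on real subspaces: dimension, closedness, orthogonal
  decomposition.\<close>

lemma cmat_subspace_imp_subspace: "cmat.subspace W \<Longrightarrow> subspace W"
  by (simp add: subspace_def cmat.subspace_def scaleR_eq_cmat_scale)

lemma span_subset_cmat_span: "span X \<subseteq> cmat.span X"
  by (intro span_minimal cmat.span_superset cmat_subspace_imp_subspace cmat.subspace_span)

text \<open>Multiplication on both sides is linear, so generators suffice. Taking \<open>a\<close>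
  or \<open>b\<close> to be \<open>mat 1\<close> gives the one-sided versions.\<close>

lemma mult_cmat_span:
  assumes "cmat.subspace W" "\<And>x. x \<in> X \<Longrightarrow> a ** x ** b \<in> W" "y \<in> cmat.span X"
  shows "a ** y ** b \<in> W"
  using assms(3)
proof (induction rule: cmat.span_induct)
  show "cmat.subspace {y. a ** y ** b \<in> W}"
    using assms(1) by (auto simp: cmat.subspace_def cmat_scale_mult matrix_add_ldistrib matrix_add_rdistrib)
qed (use assms(2) in auto)

text \<open>The expression is conjugate linear in \<open>v\<close>, but the admissible
  \<open>v\<close> still form a complex subspace, because \<open>W\<close> is closed under
  conjugated scalars too.\<close>

lemma adj_sandwich_cmat_span:
  assumes W: "cmat.subspace W" and X: "\<And>v w. v \<in> X \<Longrightarrow> w \<in> X \<Longrightarrow> cmat_adj v ** t ** w \<in> W"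
    and v: "v \<in> cmat.span X" and w: "w \<in> cmat.span X"
  shows "cmat_adj v ** t ** w \<in> W"
  using v
proof (induction rule: cmat.span_induct)
  show "cmat.subspace {v. cmat_adj v ** t ** w \<in> W}"
    using W by (auto simp: cmat.subspace_def cmat_scale_mult matrix_add_rdistrib)
next
  fix v assume "v \<in> X"
  then show "cmat_adj v ** t ** w \<in> W"
    using mult_cmat_span[OF W _ w, of "cmat_adj v ** t" "mat 1"] X by simp
qed

lemma sandwich_adj_cmat_span:
  assumes W: "cmat.subspace W" and X: "\<And>v w. v \<in> X \<Longrightarrow> w \<in> X \<Longrightarrow> v ** s ** cmat_adj w \<in> W"
    and v: "v \<in> cmat.span X" and w: "w \<in> cmat.span X"
  shows "v ** s ** cmat_adj w \<in> W"
  using w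
proof (induction rule: cmat.span_induct)
  show "cmat.subspace {w. v ** s ** cmat_adj w \<in> W}"
    using W by (auto simp: cmat.subspace_def cmat_scale_mult matrix_add_ldistrib)
next
  fix w assume "w \<in> X"
  then show "v ** s ** cmat_adj w \<in> W"
    using mult_cmat_span[OF W _ v, of "mat 1" "s ** cmat_adj w"] X by (simp add: matrix_mul_assoc)
qed

text \<open>Used with \<open>a = mat 1\<close>: if the identity lies in the span, a vector killed by
  all generators is zero.\<close>

lemma vanish_cmat_span:
  assumes "\<And>x. x \<in> X \<Longrightarrow> x *v \<xi> = 0" "a \<in> cmat.span X"
  shows "a *v \<xi> = 0"
  using assms(2)
proof (induction rule: cmat.span_induct)
  show "cmat.subspace {a. a *v \<xi> = 0}"
    by (auto simp: cmat.subspace_def cmat_scale_mult_vector matrix_vector_mult_add_rdistrib)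
qed (use assms(1) in auto)

lemma mult_closed_cmat_span:
  assumes "\<And>x y. x \<in> X \<Longrightarrow> y \<in> X \<Longrightarrow> x ** y \<in> cmat.span X"
    and a: "a \<in> cmat.span X" and b: "b \<in> cmat.span X"
  shows "a ** b \<in> cmat.span X"
proof -
  have "x ** b \<in> cmat.span X" if "x \<in> X" for x
    using mult_cmat_span[OF cmat.subspace_span _ b, where a = x and b = "mat 1"] assms(1) that by simp
  then show ?thesis
    using mult_cmat_span[OF cmat.subspace_span _ a, where a = "mat 1" and b = b] by simp
qed

text \<open>Left multiplication by an invertible \<open>d\<close> in a finite-dimensional algebra is injective,
  hence onto: \<open>d\<close> itself and then the identity are in its image.\<close>

lemma algebra_inverse:
  fixes A :: "(complex^'n^'n) set"
  assumes A: "cmat.subspace A" "\<And>a b. a \<in> A \<Longrightarrow> b \<in> A \<Longrightarrow> a ** b \<in> A"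
    and d: "d \<in> A" "e ** d = mat 1"
  shows "mat 1 \<in> A" "e \<in> A"
proof -
  have cancel: "x = e ** y" if "d ** x = y" for x y :: "complex^'n^'n"
    using that d(2) by (metis matrix_mul_assoc matrix_mul_lid)
  have sub: "subspace A"
    by (rule cmat_subspace_imp_subspace[OF A(1)])
  have lin: "linear ((**) d)"
    by (intro linearI) (simp_all add: matrix_add_ldistrib scaleR_eq_cmat_scale cmat_scale_mult)
  have "inj_on ((**) d) (span A)"
    using cancel by (intro inj_onI) metis
  then have "dim ((**) d ` A) = dim A"
    by (rule dim_image_eq[OF lin])
  moreover have "(**) d ` A \<subseteq> A"
    using A(2) d(1) by blast
  moreover have "subspace ((**) d ` A)"
    by (rule linear_subspace_image[OF lin sub])
  ultimately have onto: "(**) d ` A = A"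
    using sub by (metis order_refl subspace_dim_equal)
  then obtain x where "x \<in> A" "d ** x = d"
    using d(1) by (metis imageE)
  then show 1: "mat 1 \<in> A"
    using cancel d(2) by metis
  then obtain x where "x \<in> A" "d ** x = mat 1"
    using onto by (metis imageE)
  then show "e \<in> A"
    using cancel by (metis matrix_mul_rid)
qed

section \<open>Kernels and bounds of Gram matrices\<close>

lemma left_invertible_if_kernel_0:
  fixes A :: "complex^'n^'m"
  assumes "\<And>\<xi>. A *v \<xi> = 0 \<Longrightarrow> \<xi> = 0"
  obtains B where "B ** A = mat 1"
proof -
  have "inj ((*v) A)"
    using assms by (intro injI) (metis eq_iff_diff_eq_0 matrix_vector_mult_diff_distrib)
  then show ?thesis
    using that matrix_left_invertible_injective by blast
qed

lemma inner_gram_matrix: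
  "\<xi> \<bullet> ((\<Sum>v\<leftarrow>vs. cmat_adj v ** v) *v \<xi>) = (\<Sum>v\<leftarrow>vs. (norm (v *v \<xi>))\<^sup>2)"
proof (induction vs)
  case (Cons v vs)
  have "\<xi> \<bullet> ((cmat_adj v ** v) *v \<xi>) = (norm (v *v \<xi>))\<^sup>2"
    by (metis inner_cmat_adj matrix_vector_mul_assoc power2_norm_eq_inner)
  with Cons show ?case
    by (simp add: matrix_vector_mult_add_rdistrib inner_add_right)
qed simp

text \<open>The quadratic form of the Gram matrix is a sum of squared norms, which vanishes only if
  every term does.\<close>

lemma gram_matrix_kernel:
  assumes "(\<Sum>v\<leftarrow>vs. cmat_adj v ** v) *v \<xi> = 0" "v \<in> set vs"
  shows "v *v \<xi> = 0"
proof -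
  have "(\<Sum>v\<leftarrow>vs. (norm (v *v \<xi>))\<^sup>2) = 0"
    using inner_gram_matrix[of \<xi> vs] assms(1) by simp
  then have "\<forall>x\<in>set (map (\<lambda>v. (norm (v *v \<xi>))\<^sup>2) vs). x = 0"
    by (subst (asm) sum_list_nonneg_eq_0_iff) auto
  then show ?thesis
    using assms(2) by auto
qed

lemma matrix_vector_mult_bound:
  fixes A :: "complex^'n^'m"
  obtains K where "\<And>\<xi>. (norm (A *v \<xi>))\<^sup>2 \<le> K * (norm \<xi>)\<^sup>2"
proof -
  have "norm (A *v \<xi>) \<le> onorm ((*v) A) * norm \<xi>" for \<xi>
    by (intro onorm matrix_vector_mul_bounded_linear)
  then have "(norm (A *v \<xi>))\<^sup>2 \<le> (onorm ((*v) A))\<^sup>2 * (norm \<xi>)\<^sup>2" for \<xi>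
    by (metis norm_ge_zero power_mono power_mult_distrib)
  then show ?thesis
    using that by blast
qed

text \<open>The bound says \<open>A\<^sup>2 \<le> C A\<close>. It expresses positivity of
  \<open>A\<close> together with an upper bound, in a form that needs no spectral theory and passes
  through an induction over the list.\<close>

lemma gram_matrix_bound:
  fixes vs :: "(complex^'n^'m) list"
  defines "A \<equiv> (\<Sum>v\<leftarrow>vs. cmat_adj v ** v)"
  obtains C where "C \<ge> 0" "\<And>\<xi>. (norm (A *v \<xi>))\<^sup>2 \<le> C * (\<xi> \<bullet> (A *v \<xi>))"
proof -
  have "\<exists>C\<ge>0. \<forall>\<xi>. (norm ((\<Sum>v\<leftarrow>vs. cmat_adj v ** v) *v \<xi>))\<^sup>2 \<le> C * (\<Sum>v\<leftarrow>vs. (norm (v *v \<xi>))\<^sup>2)"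
  proof (induction vs)
    case (Cons v vs)
    then obtain C where C: "C \<ge> 0"
      "\<And>\<xi>. (norm ((\<Sum>v\<leftarrow>vs. cmat_adj v ** v) *v \<xi>))\<^sup>2 \<le> C * (\<Sum>v\<leftarrow>vs. (norm (v *v \<xi>))\<^sup>2)"
      by blast
    obtain K where K: "\<And>\<xi>. (norm (cmat_adj v *v \<xi>))\<^sup>2 \<le> K * (norm \<xi>)\<^sup>2"
      using matrix_vector_mult_bound by blast
    \<comment> \<open>The factor 2 comes from
      \<open>(p + q)\<^sup>2 \<le> 2 p\<^sup>2 + 2 q\<^sup>2\<close>; the absolute value is taken
      because \<open>K\<close> comes without a sign.\<close>
    have "(norm ((\<Sum>v\<leftarrow>v#vs. cmat_adj v ** v) *v \<xi>))\<^sup>2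
        \<le> (2 * (\<bar>K\<bar> + C)) * (\<Sum>v\<leftarrow>v#vs. (norm (v *v \<xi>))\<^sup>2)" (is "?l \<le> _") for \<xi>
    proof -
      let ?a = "cmat_adj v *v (v *v \<xi>)" and ?b = "(\<Sum>v\<leftarrow>vs. cmat_adj v ** v) *v \<xi>"
      let ?n = "(norm (v *v \<xi>))\<^sup>2" and ?r = "(\<Sum>v\<leftarrow>vs. (norm (v *v \<xi>))\<^sup>2)"
      have "?l = (norm (?a + ?b))\<^sup>2"
        by (simp add: matrix_vector_mult_add_rdistrib matrix_vector_mul_assoc)
      also have "\<dots> \<le> 2 * (norm ?a)\<^sup>2 + 2 * (norm ?b)\<^sup>2"
      proof -
        have "(norm (?a + ?b))\<^sup>2 \<le> (norm ?a + norm ?b)\<^sup>2"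
          by (simp add: norm_triangle_ineq power_mono)
        also have "\<dots> \<le> 2 * (norm ?a)\<^sup>2 + 2 * (norm ?b)\<^sup>2"
          using sum_squares_bound[of "norm ?a" "norm ?b"] by (simp add: power2_sum)
        finally show ?thesis .
      qed
      also have "\<dots> \<le> 2 * (\<bar>K\<bar> * ?n) + 2 * (C * ?r)"
      proof -
        have "K * ?n \<le> \<bar>K\<bar> * ?n"
          by (intro mult_right_mono) auto
        then show ?thesis
          using K[of "v *v \<xi>"] C(2)[of \<xi>] by linarith
      qed
      also have "\<dots> \<le> 2 * ((\<bar>K\<bar> + C) * ?n) + 2 * ((\<bar>K\<bar> + C) * ?r)"
        by (intro add_mono mult_left_mono mult_right_mono sum_list_nonneg) (use C(1) in auto)
      finally show ?thesis
        by (simp add: algebra_simps)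
    qed
    moreover have "0 \<le> 2 * (\<bar>K\<bar> + C)"
      using C(1) by simp
    ultimately show ?case
      by blast
  qed auto
  then show ?thesis
    using that unfolding A_def inner_gram_matrix by blast
qed

section \<open>Square roots in matrix algebras\<close>

lemma cmat_mult_diff:
  "(A - B) ** C = A ** C - B ** (C :: complex^'n^'m)"
  "C ** (D - E) = C ** D - C ** (E :: complex^'k^'n)"
  by (simp_all add: matrix_matrix_mult_def vec_eq_iff sum_subtractf algebra_simps)

lemma continuous_on_matrix_mult [continuous_intros]:
  fixes f :: "'a::topological_space \<Rightarrow> complex^'n^'m" and g :: "'a \<Rightarrow> complex^'k^'n"
  assumes "continuous_on X f" "continuous_on X g"
  shows "continuous_on X (\<lambda>x. f x ** g x)"
  unfolding matrix_matrix_mult_def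
  by (intro continuous_on_vec_lambda continuous_on_sum continuous_on_mult
      continuous_on_component assms)

lemma continuous_on_cmat_adj [continuous_intros]:
  fixes f :: "'a::topological_space \<Rightarrow> complex^'n^'m"
  assumes "continuous_on X f"
  shows "continuous_on X (\<lambda>x. cmat_adj (f x))"
  unfolding cmat_adj_def
  by (intro continuous_on_vec_lambda continuous_on_cnj continuous_on_component assms)

lemma continuous_on_matrix_vector_mult [continuous_intros]:
  fixes f :: "'a::topological_space \<Rightarrow> complex^'n^'m"
  assumes "continuous_on X f"
  shows "continuous_on X (\<lambda>x. f x *v \<xi>)"
  unfolding matrix_vector_mult_def
  by (intro continuous_on_vec_lambda continuous_on_sum continuous_on_mult
      continuous_on_component continuous_on_const assms)

lemma cmat_scaleR_mult_vector: "(r *\<^sub>R A) *v \<xi> = r *\<^sub>R (A *v (\<xi> :: complex^'n))"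
  by (simp add: matrix_vector_mult_def vec_eq_iff scaleR_right.sum)

text \<open>The norm of the matrix type is Euclidean, not the operator norm. Applying
  \<open>Y\<close> to basis vectors bounds each entry by 1; this crude estimate is enough for
  compactness.\<close>

lemma contraction_norm_bound:
  fixes Y :: "complex^'n^'m"
  assumes "\<And>\<xi>. norm (Y *v \<xi>) \<le> norm \<xi>"
  shows "norm Y \<le> real CARD('m) * real CARD('n)"
proof -
  have entry: "norm (Y$i$j) \<le> 1" for i j
  proof -
    have "norm (Y$i$j) \<le> norm (Y *v axis j 1)"
      using Finite_Cartesian_Product.norm_nth_le[of "Y *v axis j 1" i]
      by (simp add: matrix_vector_mult_def axis_def if_distrib cong: if_cong)
    also have "\<dots> \<le> 1"
      using assms[of "axis j 1"] by simp
    finally show ?thesis .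
  qed
  have L1: "norm x \<le> (\<Sum>i\<in>UNIV. norm (x$i))" for x :: "'a::real_normed_vector^'k"
    by (subst norm_vec_def) (simp add: L2_set_le_sum)
  have "norm Y \<le> (\<Sum>i\<in>UNIV. \<Sum>j\<in>UNIV. norm (Y$i$j))"
    by (intro order_trans[OF L1] sum_mono L1)
  also have "\<dots> \<le> (\<Sum>i\<in>(UNIV::'m set). \<Sum>j\<in>(UNIV::'n set). 1)"
    by (intro sum_mono entry)
  finally show ?thesis
    by simp
qed

text \<open>The square root of \<open>1 - e\<close> is \<open>1 - y\<close> for a fixed point \<open>y\<close> of \<open>y \<mapsto> (e + y\<^sup>2) / 2\<close>,
  a map of the self-adjoint contractions of the algebra into themselves.\<close>

lemma selfadjoint_sqrt_contraction:
  fixes A :: "(complex^'n^'n) set"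
  assumes A: "cmat.subspace A" "\<And>a b. a \<in> A \<Longrightarrow> b \<in> A \<Longrightarrow> a ** b \<in> A" "mat 1 \<in> A"
    and e: "e \<in> A" "cmat_adj e = e" "\<And>\<xi>. norm (e *v \<xi>) \<le> norm \<xi>"
  obtains d where "d \<in> A" "cmat_adj d = d" "d ** d = mat 1 - e"
proof -
  \<comment> \<open>Each of the three conditions is closed and convex, so \<open>B\<close> is a
    compact convex set to which Brouwer's theorem applies.\<close>
  define B where "B = A \<inter> {y. cmat_adj y = y} \<inter> (\<Inter>\<xi>. {y. norm (y *v \<xi>) \<le> norm \<xi>})"
  define f where "f y = (1/2) *\<^sub>R (e + y ** y)" for y
  have sub: "subspace A"
    by (rule cmat_subspace_imp_subspace[OF A(1)])
  have "closed {y :: complex^'n^'n. cmat_adj y = y}"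
    by (intro closed_Collect_eq continuous_on_cmat_adj continuous_on_id)
  moreover have "closed {y :: complex^'n^'n. norm (y *v \<xi>) \<le> norm \<xi>}" for \<xi>
    by (intro closed_Collect_le continuous_on_norm continuous_on_matrix_vector_mult
        continuous_on_id continuous_on_const)
  ultimately have "closed B"
    unfolding B_def using closed_subspace[OF sub] by (intro closed_Int closed_INT ballI)
  moreover have "norm y \<le> real CARD('n) * real CARD('n)" if "y \<in> B" for y
    using that by (intro contraction_norm_bound) (simp add: B_def)
  then have "bounded B"
    unfolding bounded_iff by blast
  ultimately have "compact B"
    by (simp add: compact_eq_bounded_closed)
  moreover have "convex B"
  proof (rule convexI)
    fix x y and u v :: real
    assume xy: "x \<in> B" "y \<in> B" and uv: "0 \<le> u" "0 \<le> v" "u + v = 1"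
    have "norm ((u *\<^sub>R x + v *\<^sub>R y) *v \<xi>) \<le> norm \<xi>" for \<xi>
    proof -
      have "(u *\<^sub>R x + v *\<^sub>R y) *v \<xi> = u *\<^sub>R (x *v \<xi>) + v *\<^sub>R (y *v \<xi>)"
        by (simp add: matrix_vector_mult_add_rdistrib cmat_scaleR_mult_vector)
      also have "norm \<dots> \<le> u * norm (x *v \<xi>) + v * norm (y *v \<xi>)"
        using uv norm_triangle_ineq[of "u *\<^sub>R (x *v \<xi>)" "v *\<^sub>R (y *v \<xi>)"] by simp
      also have "\<dots> \<le> u * norm \<xi> + v * norm \<xi>"
        using xy uv by (intro add_mono mult_left_mono) (auto simp: B_def)
      finally show ?thesis
        using uv(3) by (simp add: distrib_right[symmetric])
    qed
    then show "u *\<^sub>R x + v *\<^sub>R y \<in> B"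
      using xy sub by (auto simp: B_def subspace_add subspace_mul)
  qed
  moreover have "0 \<in> B"
    using subspace_0[OF sub] by (simp add: B_def)
  then have "B \<noteq> {}"
    by blast
  moreover have "continuous_on B f"
    unfolding f_def by (intro continuous_intros)
  moreover have "f \<in> B \<rightarrow> B"
  proof
    fix y assume y: "y \<in> B"
    have "norm (f y *v \<xi>) \<le> norm \<xi>" for \<xi>
    proof -
      have "f y *v \<xi> = (1/2) *\<^sub>R (e *v \<xi> + y *v (y *v \<xi>))"
        unfolding f_def
        by (simp only: cmat_scaleR_mult_vector matrix_vector_mult_add_rdistrib
            matrix_vector_mul_assoc)
      moreover have "norm (e *v \<xi> + y *v (y *v \<xi>)) \<le> norm \<xi> + norm \<xi>"
      proof (intro norm_triangle_mono e(3))
        have "norm (y *v (y *v \<xi>)) \<le> norm (y *v \<xi>)" "norm (y *v \<xi>) \<le> norm \<xi>"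
          using y by (auto simp: B_def)
        then show "norm (y *v (y *v \<xi>)) \<le> norm \<xi>"
          by linarith
      qed
      ultimately show ?thesis
        by simp
    qed
    then show "f y \<in> B"
      using y sub A(2) e(1,2) by (auto simp: B_def f_def subspace_add subspace_mul)
  qed
  ultimately obtain y where y: "y \<in> B" "f y = y"
    using brouwer by blast
  \<comment> \<open>The fixed point equation reads \<open>2 y = e + y\<^sup>2\<close>, which is
    \<open>(1 - y)\<^sup>2 = 1 - e\<close> after expansion.\<close>
  have "y + y = 2 *\<^sub>R f y"
    using y(2) by (simp add: scaleR_2)
  also have "\<dots> = e + y ** y"
    by (simp add: f_def)
  finally have "(mat 1 - y) ** (mat 1 - y) = mat 1 - e"
    by (simp add: cmat_mult_diff algebra_simps)
  moreover have "mat 1 - y \<in> A" "cmat_adj (mat 1 - y) = mat 1 - y"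
    using y(1) sub A(3) by (auto simp: B_def subspace_diff)
  ultimately show ?thesis
    using that by blast
qed

text \<open>A small positive multiple \<open>c a\<close> has the form \<open>1 - e\<close> with a
  contraction \<open>e\<close>; its root is rescaled by the inverse of
  \<open>sqrt c\<close>.\<close>

lemma selfadjoint_sqrt:
  fixes A :: "(complex^'n^'n) set"
  assumes A: "cmat.subspace A" "\<And>a b. a \<in> A \<Longrightarrow> b \<in> A \<Longrightarrow> a ** b \<in> A" "mat 1 \<in> A"
    and a: "a \<in> A" "cmat_adj a = a" "\<And>\<xi>. (norm (a *v \<xi>))\<^sup>2 \<le> C * (\<xi> \<bullet> (a *v \<xi>))" and C: "C \<ge> 0"
  obtains d where "d \<in> A" "cmat_adj d = d" "d ** d = a"
proof -
  \<comment> \<open>Any \<open>c > 0\<close> with \<open>c C \<le> 2\<close> makes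
    \<open>1 - c a\<close> a contraction: the term \<open>c\<^sup>2 C\<close> is then absorbed by
    \<open>2 c\<close>. The summand 1 keeps \<open>c\<close> positive when
    \<open>C = 0\<close>.\<close>
  define c where "c = 1 / (C + 1)"
  have c: "c > 0" "c * C \<le> 2"
    using C by (simp_all add: c_def field_simps)
  define e where "e = mat 1 - c *\<^sub>R a"
  have sub: "subspace A"
    by (rule cmat_subspace_imp_subspace[OF A(1)])
  have "norm (e *v \<xi>) \<le> norm \<xi>" for \<xi>
  proof -
    \<comment> \<open>A negative value would make the bound on the norm nonpositive, hence
      \<open>a *v \<xi> = 0\<close>, and the value would be 0.\<close>
    have pos: "\<xi> \<bullet> (a *v \<xi>) \<ge> 0"
    proof (rule ccontr)
      assume neg: "\<not> \<xi> \<bullet> (a *v \<xi>) \<ge> 0"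
      then have "C * (\<xi> \<bullet> (a *v \<xi>)) \<le> 0"
        using C by (intro mult_nonneg_nonpos) auto
      then have "(norm (a *v \<xi>))\<^sup>2 \<le> 0"
        using a(3)[of \<xi>] by linarith
      then show False
        using neg by simp
    qed
    have "e *v \<xi> = \<xi> - c *\<^sub>R (a *v \<xi>)"
      by (simp add: e_def matrix_vector_mult_diff_rdistrib cmat_scaleR_mult_vector)
    moreover have "(norm (x - c *\<^sub>R y))\<^sup>2 = (norm x)\<^sup>2 - 2 * c * (x \<bullet> y) + c\<^sup>2 * (norm y)\<^sup>2"
      for x y :: "complex^'n"
      unfolding power2_norm_eq_inner
      by (simp add: inner_diff inner_commute power2_eq_square algebra_simps del: dot_square_norm)
    ultimately have "(norm (e *v \<xi>))\<^sup>2 = (norm \<xi>)\<^sup>2 - 2 * c * (\<xi> \<bullet> (a *v \<xi>)) + c\<^sup>2 * (norm (a *v \<xi>))\<^sup>2"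
      by simp
    moreover have "c\<^sup>2 * (norm (a *v \<xi>))\<^sup>2 \<le> 2 * c * (\<xi> \<bullet> (a *v \<xi>))"
    proof -
      have "c\<^sup>2 * (norm (a *v \<xi>))\<^sup>2 \<le> c\<^sup>2 * (C * (\<xi> \<bullet> (a *v \<xi>)))"
        by (intro mult_left_mono a(3)) simp
      also have "\<dots> = (c * C) * (c * (\<xi> \<bullet> (a *v \<xi>)))"
        by (simp add: power2_eq_square mult_ac)
      also have "\<dots> \<le> 2 * (c * (\<xi> \<bullet> (a *v \<xi>)))"
        using c pos by (intro mult_right_mono) auto
      finally show ?thesis
        by simp
    qed
    ultimately have "(norm (e *v \<xi>))\<^sup>2 \<le> (norm \<xi>)\<^sup>2"
      by linarith
    then show ?thesis
      by (rule power2_le_imp_le) simp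
  qed
  then obtain d where d: "d \<in> A" "cmat_adj d = d" "d ** d = mat 1 - e"
    using selfadjoint_sqrt_contraction[OF A, of e] a(1,2) A(3) sub
    by (auto simp: e_def subspace_diff subspace_mul)
  show ?thesis
  proof (rule that)
    show "(1 / sqrt c) *\<^sub>R d \<in> A" "cmat_adj ((1 / sqrt c) *\<^sub>R d) = (1 / sqrt c) *\<^sub>R d"
      using d sub by (simp_all add: subspace_mul)
    have "((1 / sqrt c) *\<^sub>R d) ** ((1 / sqrt c) *\<^sub>R d) = (1 / sqrt c * (1 / sqrt c)) *\<^sub>R (d ** d)"
      by (simp only: scaleR_eq_cmat_scale cmat_scale_mult cmat.scale_scale of_real_mult)
    also have "\<dots> = a"
      using c(1) by (simp add: d(3) e_def)
    finally show "((1 / sqrt c) *\<^sub>R d) ** ((1 / sqrt c) *\<^sub>R d) = a" .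
  qed
qed

section \<open>Kraus representations\<close>

text \<open>The standard matrix units. Nested conditionals, rather than a conjunction, let a sum
  over either index collapse separately.\<close>

definition cmat_unit :: "'m \<Rightarrow> 'n \<Rightarrow> complex^'n^'m" where
  "cmat_unit a b = (\<chi> i j. if i = a then if j = b then 1 else 0 else 0)"

lemma cmat_unit_sandwich:
  fixes u :: "complex^'n^'m" and v :: "complex^'k^'l"
  shows "(cmat_adj u ** cmat_unit a b ** v)$p$q = cnj (u$a$p) * v$b$q"
proof -
  have "(cmat_adj u ** cmat_unit a b)$p$k = (if k = b then cnj (u$a$p) else 0)" for k
    by (simp add: matrix_matrix_mult_def cmat_adj_def cmat_unit_def if_distrib cong: if_cong)
  then show ?thesis
    by (subst matrix_matrix_mult_def) (simp add: if_distribR if_distrib[of "\<lambda>x. x * _"] cong: if_cong)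
qed

lemma cmat_eq_sum_units: "A = (\<Sum>a\<in>UNIV. \<Sum>b\<in>UNIV. cmat_scale (A$a$b) (cmat_unit a b))"
proof -
  have "(\<Sum>b\<in>UNIV. cmat_scale (A$a$b) (cmat_unit a b)) $ i $ j = (if i = a then A$a$j else 0)" for a i j
    by (cases "i = a") (simp_all add: cmat_scale_def cmat_unit_def mult_delta_right)
  then show ?thesis
    by (simp add: vec_eq_iff)
qed

text \<open>These are the entries of the Choi matrix of \<open>\<phi>\<close>, written as a Gram
  matrix of the flattened Kraus operators. Both uniqueness and existence of Kraus representations
  rest on this formula.\<close>

lemma kraus_representation_cmat_unit:
  assumes "kraus_representation \<phi> vs"
  shows "\<phi> (cmat_unit a b) $ p $ q = (\<Sum>u\<leftarrow>vs. cnj (u$a$p) * u$b$q)"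
proof -
  have "(\<Sum>v\<leftarrow>vs. cmat_adj v ** cmat_unit a b ** v)$p$q = (\<Sum>u\<leftarrow>vs. cnj (u$a$p) * u$b$q)"
    by (induction vs) (simp_all add: cmat_unit_sandwich)
  then show ?thesis
    using assms by (simp add: kraus_representation_def)
qed

lemma linear_kraus:
  assumes "kraus_representation \<phi> vs"
  shows "Vector_Spaces.linear cmat_scale cmat_scale \<phi>"
proof -
  have "(\<Sum>v\<leftarrow>vs. cmat_adj v ** (a + b) ** v)
      = (\<Sum>v\<leftarrow>vs. cmat_adj v ** a ** v) + (\<Sum>v\<leftarrow>vs. cmat_adj v ** b ** v)" for a b
    by (simp add: matrix_add_ldistrib matrix_add_rdistrib sum_list_addf)
  moreover have "(\<Sum>v\<leftarrow>vs. cmat_adj v ** cmat_scale c b ** v)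
      = cmat_scale c (\<Sum>v\<leftarrow>vs. cmat_adj v ** b ** v)" for c b
    by (induction vs) (simp_all add: cmat_scale_mult cmat.scale_right_distrib)
  ultimately show ?thesis
    using assms by (simp add: kraus_representation_def Vector_Spaces.linear_iff cmat.vector_space_axioms)
qed

text \<open>For one Kraus operator \<open>v\<close>, the form of the compressed blocks at
  \<open>\<xi>\<close> is the form of \<open>B\<close> at the vectors \<open>v *v \<xi> i\<close>;
  sums of nonnegative forms are nonnegative.\<close>

lemma completely_positive_kraus:
  fixes \<phi> :: "complex^'m^'m \<Rightarrow> complex^'n^'n"
  assumes "kraus_representation \<phi> vs"
  shows "completely_positive \<phi>"
proof -
  have "block_positive k (\<lambda>i j. \<phi> (B i j))" if B: "block_positive k B" for k B
    unfolding block_positive_def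
  proof
    fix \<xi> :: "nat \<Rightarrow> complex^'n"
    have "(\<Sum>i<k. \<Sum>j<k. \<Sum>a\<in>UNIV. cnj (\<xi> i $ a) * ((cmat_adj v ** B i j ** v) *v \<xi> j) $ a) \<in> \<real>\<^sub>\<ge>\<^sub>0" for v
    proof -
      have "(\<Sum>a\<in>UNIV. cnj (\<xi> i $ a) * ((cmat_adj v ** B i j ** v) *v \<xi> j) $ a)
          = (\<Sum>a\<in>UNIV. cnj ((v *v \<xi> i) $ a) * (B i j *v (v *v \<xi> j)) $ a)" for i j
        by (simp only: matrix_vector_mul_assoc[symmetric] sum_cnj_mult_cmat_adj)
      then show ?thesis
        using B[unfolded block_positive_def, rule_format, of "\<lambda>i. v *v \<xi> i"] by simp
    qed
    then have "(\<Sum>i<k. \<Sum>j<k. \<Sum>a\<in>UNIV. cnj (\<xi> i $ a) *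
        ((\<Sum>v\<leftarrow>vs. cmat_adj v ** B i j ** v) *v \<xi> j) $ a) \<in> \<real>\<^sub>\<ge>\<^sub>0" (is "?Q vs \<in> _")
    proof (induction vs)
      case (Cons v vs)
      have "?Q (v # vs) = (\<Sum>i<k. \<Sum>j<k. \<Sum>a\<in>UNIV. cnj (\<xi> i $ a) *
          ((cmat_adj v ** B i j ** v) *v \<xi> j) $ a) + ?Q vs"
        by (simp add: matrix_vector_mult_add_rdistrib distrib_left sum.distrib)
      then show ?case
        using Cons by simp
    qed simp
    then show "(\<Sum>i<k. \<Sum>j<k. \<Sum>a\<in>UNIV. cnj (\<xi> i $ a) * (\<phi> (B i j) *v \<xi> j) $ a) \<in> \<real>\<^sub>\<ge>\<^sub>0"
      using assms by (simp add: kraus_representation_def)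
  qed
  then show ?thesis
    by (simp add: completely_positive_def linear_kraus[OF assms])
qed

section \<open>The span of the Kraus operators is determined by the map\<close>

text \<open>The Hilbert-Schmidt inner product, that is, the trace of
  \<open>cmat_adj x ** u\<close>.\<close>

definition hs_inner :: "complex^'n^'m \<Rightarrow> complex^'n^'m \<Rightarrow> complex" where
  "hs_inner x u = (\<Sum>a\<in>UNIV. \<Sum>p\<in>UNIV. cnj (x$a$p) * u$a$p)"

lemma hs_inner_scale: "hs_inner x (cmat_scale c u) = c * hs_inner x u"
  by (simp add: hs_inner_def cmat_scale_def sum_distrib_left mult_ac)

lemma inner_eq_Re_hs_inner: "x \<bullet> u = Re (hs_inner x u)"
  by (simp add: hs_inner_def inner_vec_def inner_complex_def)

text \<open>Expanding the squared moduli leaves the Kraus operators only in the combination giving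
  the Choi matrix, so the right-hand side depends on \<open>\<phi>\<close> and \<open>x\<close>
  alone.\<close>

lemma sum_hs_inner_kraus:
  assumes "kraus_representation \<phi> vs"
  shows "complex_of_real (\<Sum>u\<leftarrow>vs. (cmod (hs_inner x u))\<^sup>2)
    = (\<Sum>a\<in>UNIV. \<Sum>p\<in>UNIV. \<Sum>b\<in>UNIV. \<Sum>q\<in>UNIV. x$a$p * cnj (x$b$q) * \<phi> (cmat_unit a b) $ p $ q)"
proof -
  have "of_real ((cmod (hs_inner x u))\<^sup>2)
    = (\<Sum>a\<in>UNIV. \<Sum>p\<in>UNIV. \<Sum>b\<in>UNIV. \<Sum>q\<in>UNIV. x$a$p * cnj (x$b$q) * (cnj (u$a$p) * u$b$q))" for u
  proof -
    have "of_real ((cmod (hs_inner x u))\<^sup>2) = cnj (hs_inner x u) * hs_inner x u"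
      by (subst complex_norm_square) (rule mult.commute)
    also have "\<dots> = (\<Sum>a\<in>UNIV. \<Sum>p\<in>UNIV. (x$a$p * cnj (u$a$p)) *
        (\<Sum>b\<in>UNIV. \<Sum>q\<in>UNIV. cnj (x$b$q) * u$b$q))"
      by (simp add: hs_inner_def sum_distrib_right)
    finally show ?thesis
      by (simp add: sum_distrib_left mult_ac)
  qed
  then have "of_real (\<Sum>u\<leftarrow>vs. (cmod (hs_inner x u))\<^sup>2)
    = (\<Sum>a\<in>UNIV. \<Sum>p\<in>UNIV. \<Sum>b\<in>UNIV. \<Sum>q\<in>UNIV. x$a$p * cnj (x$b$q) * (\<Sum>u\<leftarrow>vs. cnj (u$a$p) * u$b$q))"
    by (induction vs) (simp_all add: distrib_left sum.distrib del: of_real_power)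
  then show ?thesis
    by (simp add: kraus_representation_cmat_unit[OF assms])
qed

text \<open>A matrix is orthogonal to every Kraus operator iff a quadratic form determined by \<open>\<phi>\<close>
  alone vanishes on it, so two representations have the same orthogonal complement.\<close>

lemma kraus_representation_unique:
  fixes vs ws :: "(complex^'n^'m) list"
  assumes vs: "kraus_representation \<phi> vs" and ws: "kraus_representation \<phi> ws"
  shows "set ws \<subseteq> cmat.span (set vs)"
proof
  fix w assume w: "w \<in> set ws"
  let ?U = "cmat.span (set vs)"
  have "span ?U = ?U"
    by (intro span_eq_iff[THEN iffD2] cmat_subspace_imp_subspace cmat.subspace_span)
  then obtain y z where yz: "y \<in> ?U" "\<And>u. u \<in> ?U \<Longrightarrow> orthogonal z u" "w = y + z"
    by (metis orthogonal_subspace_decomp_exists)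
  have "hs_inner z u = 0" if "u \<in> set vs" for u
  proof -
    \<comment> \<open>Orthogonality in the decomposition is real. Testing against both
      \<open>u\<close> and its multiple by \<open>\<i>\<close> recovers the complex inner
      product.\<close>
    have "u \<in> ?U" "cmat_scale \<i> u \<in> ?U"
      using that by (simp_all add: cmat.span_base cmat.span_scale)
    then have "z \<bullet> u = 0" "z \<bullet> cmat_scale \<i> u = 0"
      using yz(2) by (simp_all add: orthogonal_def)
    then show ?thesis
      by (simp add: inner_eq_Re_hs_inner hs_inner_scale complex_eq_iff)
  qed
  then have "(\<Sum>u\<leftarrow>vs. (cmod (hs_inner z u))\<^sup>2) = 0"
    by (subst sum_list_nonneg_eq_0_iff) auto
  moreover have "complex_of_real (\<Sum>u\<leftarrow>ws. (cmod (hs_inner z u))\<^sup>2)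
      = complex_of_real (\<Sum>u\<leftarrow>vs. (cmod (hs_inner z u))\<^sup>2)"
    by (simp only: sum_hs_inner_kraus[OF vs] sum_hs_inner_kraus[OF ws])
  ultimately have "(\<Sum>u\<leftarrow>ws. (cmod (hs_inner z u))\<^sup>2) = 0"
    by (simp only: of_real_eq_iff)
  then have "\<forall>r\<in>set (map (\<lambda>u. (cmod (hs_inner z u))\<^sup>2) ws). r = 0"
    by (subst (asm) sum_list_nonneg_eq_0_iff) auto
  then have "z \<bullet> w = 0"
    using w by (simp add: inner_eq_Re_hs_inner)
  moreover have "z \<bullet> y = 0"
    using yz by (simp add: orthogonal_def)
  ultimately have "z = 0"
    using yz(3) by (simp add: inner_add_right)
  then show "w \<in> ?U"
    using yz by simp
qed

section \<open>Positive semidefinite forms are Gram matrices\<close>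

text \<open>Test vectors supported on two indices extract a two by two principal submatrix from the
  form.\<close>

lemma sum_two_points:
  fixes C :: "'i \<Rightarrow> 'i \<Rightarrow> complex"
  assumes "finite I" "k \<in> I" "i \<in> I" "k \<noteq> i"
    and x: "x = (\<lambda>j. if j = k then s else if j = i then t else 0)"
  shows "(\<Sum>a\<in>I. \<Sum>b\<in>I. cnj (x a) * C a b * x b)
    = cnj s * C k k * s + cnj s * C k i * t + cnj t * C i k * s + cnj t * C i i * t"
proof -
  have "(\<Sum>b\<in>I. cnj (x a) * C a b * x b) = (\<Sum>b\<in>{k,i}. cnj (x a) * C a b * x b)" for a
    using assms by (intro sum.mono_neutral_right) (auto simp: x)
  moreover have "(\<Sum>a\<in>I. \<Sum>b\<in>{k,i}. cnj (x a) * C a b * x b)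
      = (\<Sum>a\<in>{k,i}. \<Sum>b\<in>{k,i}. cnj (x a) * C a b * x b)"
    using assms by (intro sum.mono_neutral_right) (auto simp: x)
  ultimately show ?thesis
    using assms(4) by (simp add: x)
qed

lemma psd_diagonal:
  fixes C :: "'i \<Rightarrow> 'i \<Rightarrow> complex"
  assumes "finite I" "k \<in> I" "\<And>x. (\<Sum>a\<in>I. \<Sum>b\<in>I. cnj (x a) * C a b * x b) \<in> \<real>\<^sub>\<ge>\<^sub>0"
  shows "C k k \<in> \<real>\<^sub>\<ge>\<^sub>0"
proof -
  let ?x = "\<lambda>j. if j = k then 1 else 0 :: complex"
  have [simp]: "cnj (?x a) = ?x a" for a
    by simp
  have "(\<Sum>b\<in>I. cnj (?x a) * C a b * ?x b) = ?x a * C a k" for a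
    using assms(1,2) by (simp add: mult_delta_left mult_delta_right)
  then have "(\<Sum>a\<in>I. \<Sum>b\<in>I. cnj (?x a) * C a b * ?x b) = C k k"
    using assms(1,2) by (simp add: mult_delta_left)
  then show ?thesis
    using assms(3)[of ?x] by simp
qed

lemma psd_hermitian:
  fixes C :: "'i \<Rightarrow> 'i \<Rightarrow> complex"
  assumes "finite I" "k \<in> I" "i \<in> I" and psd: "\<And>x. (\<Sum>a\<in>I. \<Sum>b\<in>I. cnj (x a) * C a b * x b) \<in> \<real>\<^sub>\<ge>\<^sub>0"
  shows "C i k = cnj (C k i)"
proof (cases "k = i")
  case True
  then show ?thesis
    using psd_diagonal[OF assms(1,2) psd] by (simp add: complex_nonneg_Reals_iff complex_eq_iff)
next
  case False
  have "cnj s * C k k * s + cnj s * C k i * t + cnj t * C i k * s + cnj t * C i i * t \<in> \<real>\<^sub>\<ge>\<^sub>0" for s t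
    using psd by (subst sum_two_points[OF assms(1-3) False refl, symmetric])
  \<comment> \<open>The first vector makes \<open>C k i + C i k\<close> real, the second makes
    \<open>\<i> * (C k i - C i k)\<close> real; together they give the conjugate symmetry.\<close>
  from this[of 1 1] this[of 1 \<i>] psd_diagonal[OF assms(1,2) psd] psd_diagonal[OF assms(1,3) psd]
  show ?thesis
    by (simp add: complex_nonneg_Reals_iff complex_eq_iff)
qed

lemma psd_zero_diagonal:
  fixes C :: "'i \<Rightarrow> 'i \<Rightarrow> complex"
  assumes "finite I" "k \<in> I" "i \<in> I" and psd: "\<And>x. (\<Sum>a\<in>I. \<Sum>b\<in>I. cnj (x a) * C a b * x b) \<in> \<real>\<^sub>\<ge>\<^sub>0"
    and 0: "C k k = 0"
  shows "C k i = 0"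
proof (rule ccontr)
  assume nz: "C k i \<noteq> 0"
  then have "k \<noteq> i"
    using 0 by auto
  define n where "n = (cmod (C k i))\<^sup>2"
  \<comment> \<open>With this \<open>r\<close> the form at the vector with entries
    \<open>- r * C k i\<close> and 1 equals \<open>C i i - 2 r n\<close>, which is
    \<open>- C i i - 2\<close> and hence negative.\<close>
  define r where "r = (Re (C i i) + 1) / n"
  have "n > 0"
    using nz by (simp add: n_def)
  let ?s = "- of_real r * C k i"
  have "cnj ?s * C k k * ?s + cnj ?s * C k i * 1 + cnj 1 * C i k * ?s + cnj 1 * C i i * 1 \<in> \<real>\<^sub>\<ge>\<^sub>0"
    using psd by (subst sum_two_points[OF assms(1-3) \<open>k \<noteq> i\<close> refl, symmetric])
  moreover have "C i k = cnj (C k i)"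
    by (rule psd_hermitian[OF assms(1-3) psd])
  moreover have "cnj ?s * C k i + cnj (C k i) * ?s = - of_real (2 * r) * (C k i * cnj (C k i))"
    by (simp add: algebra_simps)
  moreover have "C k i * cnj (C k i) = of_real n"
    unfolding n_def by (rule complex_norm_square[symmetric])
  ultimately have "- (of_real (2 * r) * of_real n) + C i i \<in> \<real>\<^sub>\<ge>\<^sub>0"
    using 0 by (simp add: mult.assoc)
  then have "Re (C i i) \<ge> 2 * r * n"
    by (simp add: complex_nonneg_Reals_iff)
  moreover have "r * n = Re (C i i) + 1"
    using \<open>n > 0\<close> by (simp add: r_def)
  moreover have "Re (C i i) \<ge> 0"
    using psd_diagonal[OF assms(1,3) psd] by (simp add: complex_nonneg_Reals_iff)
  ultimately show False
    by linarith
qed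

text \<open>Cholesky elimination. For \<open>C k k = 0\<close> the row and column of \<open>k\<close> vanish, and the divisions
  by \<open>C k k\<close> give \<open>0\<close>, so this case needs no separate treatment.\<close>

lemma psd_gram:
  fixes C :: "'i \<Rightarrow> 'i \<Rightarrow> complex"
  assumes "finite I" "\<And>x. (\<Sum>a\<in>I. \<Sum>b\<in>I. cnj (x a) * C a b * x b) \<in> \<real>\<^sub>\<ge>\<^sub>0"
  shows "\<exists>fs :: ('i \<Rightarrow> complex) list. \<forall>i\<in>I. \<forall>j\<in>I. C i j = (\<Sum>f\<leftarrow>fs. f i * cnj (f j))"
  using assms
proof (induction I arbitrary: C rule: finite_induct)
  case empty
  then show ?case by simp
next
  case (insert k I)
  let ?J = "insert k I"
  note psd = insert.prems
  have J: "finite ?J" "k \<in> ?J"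
    using insert by auto
  have herm: "C i k = cnj (C k i)" if "i \<in> ?J" for i
    using psd_hermitian[OF J that psd] .
  have zero: "C k i = 0" if "i \<in> ?J" "C k k = 0" for i
    using psd_zero_diagonal[OF J that(1) psd that(2)] .
  obtain c where c: "C k k = of_real c" "c \<ge> 0"
    using psd_diagonal[OF J psd] by (metis nonneg_Reals_cases)
  \<comment> \<open>The Schur complement of the pivot \<open>C k k\<close>, extended to all
    indices.\<close>
  define D where "D i j = C i j - C i k * C k j / C k k" for i j
  have "(\<Sum>a\<in>I. \<Sum>b\<in>I. cnj (x a) * D a b * x b) \<in> \<real>\<^sub>\<ge>\<^sub>0" for x
  proof -
    define s where "s = (\<Sum>b\<in>I. C k b * x b)"
    \<comment> \<open>The entry at \<open>k\<close> completes the square, so the form of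
      \<open>C\<close> at \<open>y\<close> equals the form of \<open>D\<close> at
      \<open>x\<close>.\<close>
    define y where "y = x(k := - s / C k k)"
    have y: "y k = - s / C k k" "\<And>a. a \<in> I \<Longrightarrow> y a = x a"
      using insert.hyps by (auto simp: y_def)
    have cs: "(\<Sum>a\<in>I. cnj (x a) * C a k) = cnj s"
      using herm by (simp add: s_def mult.commute)
    have "(\<Sum>a\<in>?J. \<Sum>b\<in>?J. cnj (y a) * C a b * y b)
        = cnj (y k) * C k k * y k + (\<Sum>b\<in>I. cnj (y k) * C k b * x b)
          + ((\<Sum>a\<in>I. cnj (x a) * C a k * y k) + (\<Sum>a\<in>I. \<Sum>b\<in>I. cnj (x a) * C a b * x b))"
      using insert.hyps by (simp add: y(2) sum.distrib cong: sum.cong)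
    also have "(\<Sum>b\<in>I. cnj (y k) * C k b * x b) = cnj (y k) * s"
      by (simp add: s_def sum_distrib_left mult.assoc)
    also have "(\<Sum>a\<in>I. cnj (x a) * C a k * y k) = cnj s * y k"
      by (simp add: cs[symmetric] sum_distrib_right)
    also have "cnj (y k) * C k k * y k + cnj (y k) * s
        + (cnj s * y k + (\<Sum>a\<in>I. \<Sum>b\<in>I. cnj (x a) * C a b * x b))
        = (\<Sum>a\<in>I. \<Sum>b\<in>I. cnj (x a) * C a b * x b) - cnj s * s / C k k"
      by (cases "c = 0") (simp_all add: y(1) c(1) field_simps)
    also have "cnj s * s / C k k = (\<Sum>a\<in>I. \<Sum>b\<in>I. cnj (x a) * (C a k * C k b / C k k) * x b)"
      unfolding cs[symmetric]
      by (simp add: s_def sum_distrib_left sum_distrib_right sum_divide_distrib mult_ac)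
    also have "(\<Sum>a\<in>I. \<Sum>b\<in>I. cnj (x a) * C a b * x b) - \<dots> = (\<Sum>a\<in>I. \<Sum>b\<in>I. cnj (x a) * D a b * x b)"
      by (simp add: D_def algebra_simps sum_subtractf)
    finally show ?thesis
      using psd[of y] by simp
  qed
  from insert.IH[OF this] obtain fs :: "('i \<Rightarrow> complex) list"
    where fs: "\<forall>i\<in>I. \<forall>j\<in>I. D i j = (\<Sum>f\<leftarrow>fs. f i * cnj (f j))"
    by blast
  \<comment> \<open>The column of the pivot, scaled so that its rank-one matrix is what elimination
    subtracts from \<open>C\<close>.\<close>
  define g where "g i = C i k / of_real (sqrt c)" for i
  have g: "g i * cnj (g j) = C i k * C k j / C k k" if "j \<in> ?J" for i j
  proof -
    have "g i * cnj (g j) = C i k * C k j / (of_real (sqrt c) * of_real (sqrt c))"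
      using herm[OF that] by (simp add: g_def)
    also have "of_real (sqrt c) * of_real (sqrt c) = C k k"
      using c by (metis of_real_mult abs_of_nonneg real_sqrt_mult_self)
    finally show ?thesis .
  qed
  have D0: "D k j = 0" "D j k = 0" if "j \<in> ?J" for j
    using zero[OF that] herm[OF that] by (auto simp: D_def)
  \<comment> \<open>The induction hypothesis says nothing about the values at \<open>k\<close>;
    setting them to 0 matches the vanishing row and column of \<open>D\<close>.\<close>
  have "C i j = (\<Sum>f\<leftarrow>g # map (\<lambda>f. f(k := 0)) fs. f i * cnj (f j))" if "i \<in> ?J" "j \<in> ?J" for i j
  proof -
    have "D i j = (\<Sum>f\<leftarrow>map (\<lambda>f. f(k := 0)) fs. f i * cnj (f j))"
    proof (cases "i = k \<or> j = k")
      case True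
      then show ?thesis
        using D0 that by (auto simp: comp_def)
    next
      case False
      then show ?thesis
        using fs that by (simp add: comp_def)
    qed
    moreover have "C i j = g i * cnj (g j) + D i j"
      using g[OF that(2)] by (simp add: D_def)
    ultimately show ?thesis
      by simp
  qed
  then show ?case
    by blast
qed

section \<open>The Choi matrix and existence of Kraus representations\<close>

text \<open>The quadratic form is the squared modulus of the single number \<open>s\<close>, the sum
  of the entries \<open>\<xi> j $ g j\<close>.\<close>

lemma block_positive_cmat_unit:
  fixes g :: "nat \<Rightarrow> 'm::finite"
  shows "block_positive k (\<lambda>i j. cmat_unit (g i) (g j))"
  unfolding block_positive_def
proof
  fix \<xi> :: "nat \<Rightarrow> complex^'m"
  define s where "s = (\<Sum>j<k. \<xi> j $ g j)"
  have "(\<Sum>a\<in>UNIV. cnj (\<xi> i $ a) * (cmat_unit (g i) (g j) *v \<xi> j) $ a) = cnj (\<xi> i $ g i) * \<xi> j $ g j" for i j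
  proof -
    have *: "(cmat_unit (g i) (g j) *v \<xi> j) $ a = (if a = g i then \<xi> j $ g j else 0)" for a
      by (simp add: matrix_vector_mult_def cmat_unit_def mult_delta_left)
    show ?thesis
      by (simp only: *) (simp add: mult_delta_right)
  qed
  then have "(\<Sum>i<k. \<Sum>j<k. \<Sum>a\<in>UNIV. cnj (\<xi> i $ a) * (cmat_unit (g i) (g j) *v \<xi> j) $ a) = cnj s * s"
    by (simp add: s_def sum_product)
  also have "\<dots> = of_real ((cmod s)\<^sup>2)"
    by (metis complex_norm_square mult.commute)
  finally show "(\<Sum>i<k. \<Sum>j<k. \<Sum>a\<in>UNIV. cnj (\<xi> i $ a) * (cmat_unit (g i) (g j) *v \<xi> j) $ a) \<in> \<real>\<^sub>\<ge>\<^sub>0"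
    by (simp del: of_real_power)
qed

text \<open>Complete positivity is applied to the block matrix of all matrix units. The image is the
  Choi matrix, here indexed by pairs.\<close>

lemma choi_psd:
  fixes \<phi> :: "complex^'m^'m \<Rightarrow> complex^'n^'n"
  assumes "completely_positive \<phi>"
  shows "(\<Sum>i\<in>UNIV. \<Sum>j\<in>UNIV. cnj (x i) * \<phi> (cmat_unit (fst i) (fst j)) $ snd i $ snd j * x j) \<in> \<real>\<^sub>\<ge>\<^sub>0"
proof -
  \<comment> \<open>Blocks are numbered by naturals in \<open>block_positive\<close>, so the row
    indices have to be enumerated.\<close>
  obtain g :: "nat \<Rightarrow> 'm" where g: "bij_betw g {..<CARD('m)} UNIV"
    using ex_bij_betw_nat_finite[of "UNIV :: 'm set"] by (auto simp: lessThan_atLeast0)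
  have pairs: "(\<Sum>i\<in>UNIV. f i) = (\<Sum>a\<in>UNIV. \<Sum>p\<in>UNIV. f (a, p))" for f :: "'m \<times> 'n \<Rightarrow> complex"
    by (simp add: sum.cartesian_product)
  define \<xi> where "\<xi> a = (\<chi> p. x (a, p))" for a
  have pos: "block_positive (CARD('m)) (\<lambda>i j. \<phi> (cmat_unit (g i) (g j)))"
    using assms block_positive_cmat_unit[of "CARD('m)" g]
    unfolding completely_positive_def by blast
  have "(\<Sum>i<CARD('m). \<Sum>j<CARD('m). \<Sum>p\<in>UNIV.
      cnj (\<xi> (g i) $ p) * (\<phi> (cmat_unit (g i) (g j)) *v \<xi> (g j)) $ p) \<in> \<real>\<^sub>\<ge>\<^sub>0"
    using pos unfolding block_positive_def by (rule spec)
  also have "(\<Sum>i<CARD('m). \<Sum>j<CARD('m). \<Sum>p\<in>UNIV.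
      cnj (\<xi> (g i) $ p) * (\<phi> (cmat_unit (g i) (g j)) *v \<xi> (g j)) $ p)
    = (\<Sum>a\<in>UNIV. \<Sum>b\<in>UNIV. \<Sum>p\<in>UNIV. cnj (\<xi> a $ p) * (\<phi> (cmat_unit a b) *v \<xi> b) $ p)"
    using sum.reindex_bij_betw[OF g, of "\<lambda>b. \<Sum>p\<in>UNIV. cnj (\<xi> a $ p) * (\<phi> (cmat_unit a b) *v \<xi> b) $ p" for a]
      sum.reindex_bij_betw[OF g, of "\<lambda>a. \<Sum>b\<in>UNIV. \<Sum>p\<in>UNIV. cnj (\<xi> a $ p) * (\<phi> (cmat_unit a b) *v \<xi> b) $ p"]
    by simp
  also have "\<dots> = (\<Sum>a\<in>UNIV. \<Sum>p\<in>UNIV. \<Sum>b\<in>UNIV. cnj (\<xi> a $ p) * (\<phi> (cmat_unit a b) *v \<xi> b) $ p)"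
    by (intro sum.cong refl sum.swap)
  also have "\<dots> = (\<Sum>a\<in>UNIV. \<Sum>p\<in>UNIV. \<Sum>b\<in>UNIV. \<Sum>q\<in>UNIV.
      cnj (x (a, p)) * \<phi> (cmat_unit a b) $ p $ q * x (b, q))"
    by (simp add: \<xi>_def matrix_vector_mult_def sum_distrib_left mult.assoc)
  also have "\<dots> = (\<Sum>i\<in>UNIV. \<Sum>j\<in>UNIV. cnj (x i) * \<phi> (cmat_unit (fst i) (fst j)) $ snd i $ snd j * x j)"
    by (simp only: pairs fst_conv snd_conv)
  finally show ?thesis .
qed

text \<open>Choi's theorem: Gram vectors of the Choi matrix, reshaped into matrices, are Kraus
  operators. Agreement on matrix units suffices by linearity.\<close>

lemma kraus_representation_exists:
  fixes \<phi> :: "complex^'m^'m \<Rightarrow> complex^'n^'n"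
  assumes "completely_positive \<phi>"
  shows "\<exists>vs. kraus_representation \<phi> vs"
proof -
  obtain fs :: "('m \<times> 'n \<Rightarrow> complex) list" where fs:
    "\<And>i j. \<phi> (cmat_unit (fst i) (fst j)) $ snd i $ snd j = (\<Sum>f\<leftarrow>fs. f i * cnj (f j))"
    using psd_gram[OF finite choi_psd[OF assms]] by auto
  \<comment> \<open>The conjugate is needed because \<open>psd_gram\<close> conjugates the second
    factor, whereas the Kraus formula conjugates the first.\<close>
  define vs :: "(complex^'n^'m) list" where "vs = map (\<lambda>f. \<chi> a p. cnj (f (a, p))) fs"
  define \<psi> where "\<psi> b = (\<Sum>v\<leftarrow>vs. cmat_adj v ** b ** v)" for b
  have \<psi>: "kraus_representation \<psi> vs"
    by (simp add: kraus_representation_def \<psi>_def)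
  interpret \<phi>: Vector_Spaces.linear cmat_scale cmat_scale \<phi>
    using assms by (simp add: completely_positive_def)
  interpret \<psi>: Vector_Spaces.linear cmat_scale cmat_scale \<psi>
    by (rule linear_kraus[OF \<psi>])
  have units: "\<phi> (cmat_unit a b) = \<psi> (cmat_unit a b)" for a b
    using fs[of "(a, _)" "(b, _)"]
    by (simp add: vec_eq_iff kraus_representation_cmat_unit[OF \<psi>]) (simp add: vs_def comp_def)
  have "\<phi> b = \<psi> b" for b
    by (subst (1 2) cmat_eq_sum_units[of b]) (simp add: \<phi>.sum \<psi>.sum \<phi>.scale \<psi>.scale units)
  then show ?thesis
    using \<psi> by (auto simp: kraus_representation_def)
qed

lemma kraus_ops_kraus_representation:
  "kraus_representation \<phi> vs \<Longrightarrow> kraus_representation \<phi> (kraus_ops \<phi>)"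
  unfolding kraus_ops_def by (rule someI)

text \<open>Removes the arbitrary choice in \<open>kraus_ops\<close>: its span can be computed from
  any representation at hand.\<close>

lemma span_kraus_ops:
  assumes "kraus_representation \<phi> vs"
  shows "cmat.span (set (kraus_ops \<phi>)) = cmat.span (set vs)"
  using kraus_representation_unique[OF assms kraus_ops_kraus_representation[OF assms]]
    kraus_representation_unique[OF kraus_ops_kraus_representation[OF assms] assms]
  by (simp add: cmat.span_eq)

section \<open>Ternary rings of operators\<close>

text \<open>Regrouping \<open>(x\<^sup>* y) (z\<^sup>* w)\<close> as
  \<open>x\<^sup>* (y z\<^sup>* w)\<close> uses the ternary product once, so
  \<open>[M\<^sup>* M]\<close> is an algebra.\<close>

lemma adj_mult_closed_if_TRO:
  assumes "TRO M"
    and "a \<in> cmat.span {cmat_adj x ** y | x y. x \<in> M \<and> y \<in> M}"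
    and "b \<in> cmat.span {cmat_adj x ** y | x y. x \<in> M \<and> y \<in> M}"
  shows "a ** b \<in> cmat.span {cmat_adj x ** y | x y. x \<in> M \<and> y \<in> M}"
proof (rule mult_closed_cmat_span[OF _ assms(2,3)])
  fix a b assume "a \<in> {cmat_adj x ** y | x y. x \<in> M \<and> y \<in> M}" "b \<in> {cmat_adj x ** y | x y. x \<in> M \<and> y \<in> M}"
  then obtain x y z w where xyzw: "a = cmat_adj x ** y" "b = cmat_adj z ** w" "x \<in> M" "y \<in> M" "z \<in> M" "w \<in> M"
    by blast
  then have "a ** b = cmat_adj x ** (y ** cmat_adj z ** w)" "y ** cmat_adj z ** w \<in> M"
    using assms(1) by (simp_all add: TRO_def matrix_mul_assoc)
  then show "a ** b \<in> cmat.span {cmat_adj x ** y | x y. x \<in> M \<and> y \<in> M}"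
    using xyzw(3) by (blast intro: cmat.span_base)
qed

text \<open>\<open>M\<close> is a right module over \<open>[M\<^sup>* M]\<close>, which keeps a
  renormalised spanning list inside \<open>M\<close>.\<close>

lemma TRO_mult_closed:
  assumes "TRO M" "x \<in> M" "a \<in> cmat.span {cmat_adj x ** y | x y. x \<in> M \<and> y \<in> M}"
  shows "x ** a \<in> M"
proof -
  have "x ** b ** mat 1 \<in> M" if "b \<in> {cmat_adj x ** y | x y. x \<in> M \<and> y \<in> M}" for b
    using that assms(1,2) by (auto simp: TRO_def matrix_mul_assoc)
  then show ?thesis
    using mult_cmat_span[OF _ _ assms(3), where a = x and b = "mat 1" and W = M] assms(1) by (simp add: TRO_def)
qed

text \<open>The Gram matrix \<open>a\<close> of a spanning list of \<open>M\<close> is invertible, and multiplying the list by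
  \<open>a\<^sup>-\<^sup>1\<^sup>/\<^sup>2 \<in> [M\<^sup>* M]\<close> on the right normalises it without leaving \<open>M\<close>.\<close>

lemma TRO_normalised_spanning_list:
  fixes M :: "(complex^'n^'m) set"
  assumes M: "TRO M" "nondegenerate M"
  obtains us where "cmat.span (set us) = M" "(\<Sum>u\<leftarrow>us. cmat_adj u ** u) = mat 1"
proof -
  have MS: "cmat.subspace M"
    using M(1) by (simp add: TRO_def)
  define A where "A = cmat.span {cmat_adj x ** y | x y. x \<in> M \<and> y \<in> M}"
  have A: "cmat.subspace A" "\<And>a b. a \<in> A \<Longrightarrow> b \<in> A \<Longrightarrow> a ** b \<in> A" "mat 1 \<in> A"
    using adj_mult_closed_if_TRO[OF M(1)] M(2) by (simp_all add: A_def nondegenerate_def)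
  \<comment> \<open>A finite real spanning set is enough, since it also spans \<open>M\<close> over
    the complex numbers.\<close>
  obtain B where B: "finite B" "B \<subseteq> M" "span B = M"
    using basis_subspace_exists[OF cmat_subspace_imp_subspace[OF MS]] by metis
  obtain vs where vs: "set vs = B"
    using finite_list[OF B(1)] by blast
  have span_vs: "cmat.span (set vs) = M"
    using B span_subset_cmat_span[of B] cmat.span_minimal[OF B(2) MS] vs by auto
  define a where "a = (\<Sum>v\<leftarrow>vs. cmat_adj v ** v)"
  have "a \<in> A"
    unfolding a_def using B(2) vs
    by (intro subspace_sum_list[OF A(1)]) (auto simp: A_def intro!: cmat.span_base)
  have "cmat_adj (\<Sum>v\<leftarrow>xs. cmat_adj v ** v) = (\<Sum>v\<leftarrow>xs. cmat_adj v ** v)" for xs :: "(complex^'n^'m) list"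
    by (induction xs) simp_all
  then have "cmat_adj a = a"
    by (simp add: a_def)
  \<comment> \<open>A vector killed by \<open>a\<close> is killed by the list, then by
    \<open>M\<close> and by \<open>[M\<^sup>* M]\<close>, which contains the identity by
    non-degeneracy.\<close>
  have "\<xi> = 0" if "a *v \<xi> = 0" for \<xi>
  proof -
    have "v *v \<xi> = 0" if "v \<in> set vs" for v
      using gram_matrix_kernel that \<open>a *v \<xi> = 0\<close> by (auto simp: a_def)
    then have "x *v \<xi> = 0" if "x \<in> M" for x
      using vanish_cmat_span[of "set vs" \<xi> x] span_vs that by simp
    then have "b *v \<xi> = 0" if "b \<in> {cmat_adj x ** y | x y. x \<in> M \<and> y \<in> M}" for b
      using that by (auto simp: matrix_vector_mul_assoc[symmetric])
    then have "mat 1 *v \<xi> = 0"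
      by (rule vanish_cmat_span[OF _ A(3)[unfolded A_def]])
    then show ?thesis
      by simp
  qed
  then obtain a' where a': "a' ** a = mat 1"
    using left_invertible_if_kernel_0 by blast
  obtain C where "C \<ge> 0" "\<And>\<xi>. (norm (a *v \<xi>))\<^sup>2 \<le> C * (\<xi> \<bullet> (a *v \<xi>))"
    using gram_matrix_bound[of vs] unfolding a_def by blast
  then obtain d where d: "d \<in> A" "cmat_adj d = d" "d ** d = a"
    using selfadjoint_sqrt[OF A \<open>a \<in> A\<close> \<open>cmat_adj a = a\<close>] by blast
  \<comment> \<open>This is the inverse of \<open>d\<close>, because
    \<open>a' ** d ** d = a' ** a\<close>; thus \<open>e\<close> is
    \<open>a\<^sup>-\<^sup>1\<^sup>/\<^sup>2\<close>.\<close>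
  define e where "e = a' ** d"
  have ed: "e ** d = mat 1"
    using a' d(3) by (simp add: e_def matrix_mul_assoc[symmetric])
  then have de: "d ** e = mat 1"
    by (rule matrix_left_right_inverse1)
  have e: "e \<in> A"
    using algebra_inverse(2)[OF A(1,2) d(1) ed] by simp
  define us where "us = map (\<lambda>v. v ** e) vs"
  have "set us \<subseteq> M"
    using TRO_mult_closed[OF M(1)] e B(2) vs by (auto simp: us_def A_def)
  \<comment> \<open>No part of \<open>M\<close> is lost: \<open>x = (x d) e\<close>, and
    \<open>x d\<close> is in \<open>M\<close>, hence a combination of the original list.\<close>
  moreover have "x \<in> cmat.span (set us)" if "x \<in> M" for x
  proof -
    have "x ** d \<in> cmat.span (set vs)"
      using TRO_mult_closed[OF M(1) that] d(1) span_vs by (simp add: A_def)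
    moreover have "mat 1 ** v ** e \<in> cmat.span (set us)" if "v \<in> set vs" for v
      using that by (auto simp: us_def intro: cmat.span_base)
    ultimately have "mat 1 ** (x ** d) ** e \<in> cmat.span (set us)"
      using mult_cmat_span[OF cmat.subspace_span, where a = "mat 1" and X = "set vs" and b = e] by blast
    then show ?thesis
      using de by (simp add: matrix_mul_assoc[symmetric])
  qed
  ultimately have "cmat.span (set us) = M"
    using cmat.span_minimal[OF _ MS] by blast
  moreover have "(\<Sum>u\<leftarrow>us. cmat_adj u ** u) = mat 1"
  proof -
    have "(\<Sum>u\<leftarrow>us. cmat_adj u ** u) = (\<Sum>v\<leftarrow>vs. cmat_adj e ** (cmat_adj v ** v) ** e)"
      by (simp add: us_def comp_def matrix_mul_assoc)
    also have "\<dots> = cmat_adj e ** a ** e"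
      by (simp add: a_def sum_list_mult_left sum_list_mult_right)
    also have "\<dots> = cmat_adj (d ** e) ** (d ** e)"
      by (simp add: d(2) matrix_mul_assoc flip: d(3))
    finally show ?thesis
      by (simp add: de)
  qed
  ultimately show ?thesis
    using that by blast
qed

section \<open>From an implementing TRO to a unital completely positive map\<close>

lemma adj_sandwich_span_subset:
  assumes "cmat.subspace S" "V \<subseteq> M" "\<forall>x\<in>M. \<forall>y\<in>M. \<forall>t\<in>T. cmat_adj x ** t ** y \<in> S"
  shows "cmat.span {cmat_adj v ** t ** w | v t w. t \<in> T \<and> v \<in> V \<and> w \<in> V} \<subseteq> S"
  by (rule cmat.span_minimal[OF _ assms(1)]) (use assms(2,3) in blast)

lemma sandwich_adj_span_subset:
  assumes "cmat.subspace T" "V \<subseteq> M" "\<forall>x\<in>M. \<forall>y\<in>M. \<forall>s\<in>S. x ** s ** cmat_adj y \<in> T"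
  shows "cmat.span {v ** s ** cmat_adj w | v s w. s \<in> S \<and> v \<in> V \<and> w \<in> V} \<subseteq> T"
  by (rule cmat.span_minimal[OF _ assms(1)]) (use assms(2,3) in blast)

text \<open>Write \<open>s = 1 s 1\<close> and expand both identities in the span of
  \<open>X\<close>.\<close>

lemma in_subspace_if_one_in_span:
  assumes W: "cmat.subspace W" and "mat 1 \<in> cmat.span X" "\<And>x y. x \<in> X \<Longrightarrow> y \<in> X \<Longrightarrow> x ** s ** y \<in> W"
  shows "s \<in> W"
proof -
  have *: "mat 1 ** x ** (s ** y) \<in> W" if "x \<in> cmat.span X" "y \<in> X" for x y
    using assms(3)[OF _ that(2)]
    by (intro mult_cmat_span[OF W _ that(1), where a = "mat 1" and b = "s ** y"]) (simp add: matrix_mul_assoc)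
  have "s ** y ** mat 1 \<in> W" if "y \<in> X" for y
    using *[OF assms(2) that] by simp
  then have "s ** mat 1 ** mat 1 \<in> W"
    by (intro mult_cmat_span[OF W _ assms(2), where a = s and b = "mat 1"])
  then show ?thesis
    by simp
qed

lemma ucp_if_TRO_equivalent:
  fixes S :: "(complex^'n^'n) set" and T :: "(complex^'m^'m) set"
  assumes S: "cmat.subspace S" and T: "cmat.subspace T" and "TRO_equivalent S T"
  shows "\<exists>\<phi> :: complex^'m^'m \<Rightarrow> complex^'n^'n. ucp \<phi> \<and> S = pullback T \<phi> \<and> T = pushforward S \<phi>"
proof -
  obtain M :: "(complex^'n^'m) set" where M: "TRO M" "nondegenerate M"
    and MTM: "\<forall>x\<in>M. \<forall>y\<in>M. \<forall>t\<in>T. cmat_adj x ** t ** y \<in> S"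
    and MSM: "\<forall>x\<in>M. \<forall>y\<in>M. \<forall>s\<in>S. x ** s ** cmat_adj y \<in> T"
    using assms(3) unfolding TRO_equivalent_def by blast
  obtain us where us: "cmat.span (set us) = M" "(\<Sum>u\<leftarrow>us. cmat_adj u ** u) = mat 1"
    using TRO_normalised_spanning_list[OF M] by blast
  define \<phi> where "\<phi> b = (\<Sum>v\<leftarrow>us. cmat_adj v ** b ** v)" for b
  have \<phi>: "kraus_representation \<phi> us"
    by (simp add: kraus_representation_def \<phi>_def)
  \<comment> \<open>The chosen operators may differ from \<open>us\<close>, but they have the same
    span \<open>M\<close>, and the sandwich conditions only see the span.\<close>
  define V where "V = set (kraus_ops \<phi>)"
  have V: "cmat.span V = M"
    using span_kraus_ops[OF \<phi>] us(1) by (simp add: V_def)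
  then have "V \<subseteq> M"
    using cmat.span_superset by blast
  have "ucp \<phi>"
    using completely_positive_kraus[OF \<phi>] us(2) by (simp add: ucp_def \<phi>_def)
  moreover have "S = pullback T \<phi>"
  proof
    show "pullback T \<phi> \<subseteq> S"
      using adj_sandwich_span_subset[OF S \<open>V \<subseteq> M\<close> MTM] by (simp add: pullback_def V_def)
    show "S \<subseteq> pullback T \<phi>"
    proof
      fix s assume "s \<in> S"
      let ?X = "{cmat_adj x ** y | x y. x \<in> M \<and> y \<in> M}"
      have pull: "cmat_adj x ** t ** y \<in> pullback T \<phi>" if "x \<in> M" "y \<in> M" "t \<in> T" for x y t
        unfolding pullback_def V_def[symmetric]
      proof (rule adj_sandwich_cmat_span[OF cmat.subspace_span, where X = V])
        show "x \<in> cmat.span V" "y \<in> cmat.span V"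
          using that V by simp_all
      qed (use that(3) in \<open>blast intro: cmat.span_base\<close>)
      have sandwich: "cmat_adj x ** y ** s ** (cmat_adj z ** w) \<in> pullback T \<phi>"
        if "x \<in> M" "y \<in> M" "z \<in> M" "w \<in> M" for x y z w
        using pull[of x w "y ** s ** cmat_adj z"] MSM \<open>s \<in> S\<close> that by (simp add: matrix_mul_assoc)
      show "s \<in> pullback T \<phi>"
      proof (rule in_subspace_if_one_in_span)
        show "cmat.subspace (pullback T \<phi>)"
          by (simp add: pullback_def)
        show "mat 1 \<in> cmat.span ?X"
          using M(2) by (simp add: nondegenerate_def)
      qed (use sandwich in auto)
    qed
  qed
  moreover have "T = pushforward S \<phi>"
  proof
    show "pushforward S \<phi> \<subseteq> T"
      using sandwich_adj_span_subset[OF T \<open>V \<subseteq> M\<close> MSM] by (simp add: pushforward_def V_def)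
    show "T \<subseteq> pushforward S \<phi>"
    proof
      fix t assume "t \<in> T"
      let ?X = "{x ** cmat_adj y | x y. x \<in> M \<and> y \<in> M}"
      have push: "x ** s ** cmat_adj y \<in> pushforward S \<phi>" if "x \<in> M" "y \<in> M" "s \<in> S" for x y s
        unfolding pushforward_def V_def[symmetric]
      proof (rule sandwich_adj_cmat_span[OF cmat.subspace_span, where X = V])
        show "x \<in> cmat.span V" "y \<in> cmat.span V"
          using that V by simp_all
      qed (use that(3) in \<open>blast intro: cmat.span_base\<close>)
      have sandwich: "x ** cmat_adj y ** t ** (z ** cmat_adj w) \<in> pushforward S \<phi>"
        if "x \<in> M" "y \<in> M" "z \<in> M" "w \<in> M" for x y z w
        using push[of x w "cmat_adj y ** t ** z"] MTM \<open>t \<in> T\<close> that by (simp add: matrix_mul_assoc)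
      show "t \<in> pushforward S \<phi>"
      proof (rule in_subspace_if_one_in_span)
        show "cmat.subspace (pushforward S \<phi>)"
          by (simp add: pushforward_def)
        show "mat 1 \<in> cmat.span ?X"
          using M(2) by (simp add: nondegenerate_def)
      qed (use sandwich in auto)
    qed
  qed
  ultimately show ?thesis
    by blast
qed

section \<open>From Kraus operators to the TRO they generate\<close>

text \<open>Level \<open>k\<close> is spanned by the alternating products of exactly
  \<open>3\<^sup>k\<close> generators. Elements of one level thus have equal length, as the sandwich
  conditions require.\<close>

fun odd_products :: "(complex^'n^'m) set \<Rightarrow> nat \<Rightarrow> (complex^'n^'m) set" where
  "odd_products V 0 = cmat.span V"
| "odd_products V (Suc k) = cmat.span {x ** cmat_adj y ** z | x y z.
     x \<in> odd_products V k \<and> y \<in> odd_products V k \<and> z \<in> odd_products V k}"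

lemma subspace_odd_products: "cmat.subspace (odd_products V k)"
  by (cases k) simp_all

text \<open>The factors \<open>v\<^sup>* v\<close> sum to \<open>1\<close>, so shorter products are sums of longer ones.\<close>

lemma mono_odd_products:
  assumes vs: "(\<Sum>v\<leftarrow>vs. cmat_adj v ** v) = mat 1"
  shows "mono (odd_products (set vs))"
proof (intro mono_iff_le_Suc[THEN iffD2] allI)
  fix k
  \<comment> \<open>Inserting \<open>v\<^sup>* v\<close> after \<open>x\<close> produces a triple
    product of level \<open>k\<close> only if the generators themselves belong to that level, so
    this is carried along as a hypothesis.\<close>
  have step: "odd_products (set vs) k \<subseteq> odd_products (set vs) (Suc k)" if "set vs \<subseteq> odd_products (set vs) k" for k
  proof
    fix x assume x: "x \<in> odd_products (set vs) k"
    have "(\<Sum>v\<leftarrow>vs. x ** cmat_adj v ** v) \<in> odd_products (set vs) (Suc k)"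
      using x that by (intro subspace_sum_list[OF subspace_odd_products]) (auto intro!: cmat.span_base)
    also have "(\<Sum>v\<leftarrow>vs. x ** cmat_adj v ** v) = x ** (\<Sum>v\<leftarrow>vs. cmat_adj v ** v)"
      by (simp only: sum_list_mult_left matrix_mul_assoc)
    finally show "x \<in> odd_products (set vs) (Suc k)"
      by (simp add: vs)
  qed
  have "set vs \<subseteq> odd_products (set vs) k" for k
  proof (induction k)
    case 0
    then show ?case
      by (simp add: cmat.span_superset)
  next
    case (Suc k)
    then show ?case
      using step by blast
  qed
  then show "odd_products (set vs) k \<le> odd_products (set vs) (Suc k)"
    using step by blast
qed

text \<open>The levels form a chain, so any three elements share a level \<open>k\<close>, and their
  ternary product lies in the next one.\<close>

lemma TRO_UN_odd_products:
  assumes "mono (odd_products V)"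
  shows "TRO (\<Union>k. odd_products V k)"
proof -
  have common: "\<exists>k. x \<in> odd_products V k \<and> y \<in> odd_products V k \<and> z \<in> odd_products V k"
    if "x \<in> (\<Union>k. odd_products V k)" "y \<in> (\<Union>k. odd_products V k)" "z \<in> (\<Union>k. odd_products V k)" for x y z
  proof -
    from that obtain i j l where "x \<in> odd_products V i" "y \<in> odd_products V j" "z \<in> odd_products V l"
      by blast
    moreover have "odd_products V i \<subseteq> odd_products V (i + j + l)"
      "odd_products V j \<subseteq> odd_products V (i + j + l)" "odd_products V l \<subseteq> odd_products V (i + j + l)"
      by (simp_all add: monoD[OF assms])
    ultimately show ?thesis
      by blast
  qed
  show ?thesis
    unfolding TRO_def
  proof (intro conjI ballI)
    show "cmat.subspace (\<Union>k. odd_products V k)"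
    proof (rule cmat.subspaceI)
      show "0 \<in> (\<Union>k. odd_products V k)"
        using cmat.subspace_0[OF subspace_odd_products] by blast
      show "x + y \<in> (\<Union>k. odd_products V k)"
        if "x \<in> (\<Union>k. odd_products V k)" "y \<in> (\<Union>k. odd_products V k)" for x y
        using common[OF that that(2)] cmat.subspace_add[OF subspace_odd_products] by blast
      show "cmat_scale c x \<in> (\<Union>k. odd_products V k)" if "x \<in> (\<Union>k. odd_products V k)" for c x
        using that cmat.subspace_scale[OF subspace_odd_products] by blast
    qed
  next
    fix x y z
    assume "x \<in> (\<Union>k. odd_products V k)" "y \<in> (\<Union>k. odd_products V k)" "z \<in> (\<Union>k. odd_products V k)"
    then obtain k where "x \<in> odd_products V k" "y \<in> odd_products V k" "z \<in> odd_products V k"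
      using common by blast
    then have "x ** cmat_adj y ** z \<in> odd_products V (Suc k)"
      by (auto intro!: cmat.span_base)
    then show "x ** cmat_adj y ** z \<in> (\<Union>k. odd_products V k)"
      by blast
  qed
qed

text \<open>Both claims are proved together, since each pair of outer factors switches between
  \<open>S\<close> and \<open>T\<close>: a triple product on either side applies the induction
  hypothesis three times, alternately.\<close>

lemma sandwich_odd_products:
  assumes S: "cmat.subspace S" and T: "cmat.subspace T"
    and VTV: "\<And>v w t. v \<in> V \<Longrightarrow> w \<in> V \<Longrightarrow> t \<in> T \<Longrightarrow> cmat_adj v ** t ** w \<in> S"
    and VSV: "\<And>v w s. v \<in> V \<Longrightarrow> w \<in> V \<Longrightarrow> s \<in> S \<Longrightarrow> v ** s ** cmat_adj w \<in> T"
    and "x \<in> odd_products V k" "y \<in> odd_products V k"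
  shows "t \<in> T \<Longrightarrow> cmat_adj x ** t ** y \<in> S" "s \<in> S \<Longrightarrow> x ** s ** cmat_adj y \<in> T"
proof -
  have "(\<forall>t\<in>T. cmat_adj x ** t ** y \<in> S) \<and> (\<forall>s\<in>S. x ** s ** cmat_adj y \<in> T)"
    using assms(5,6)
  proof (induction k arbitrary: x y)
    case 0
    then show ?case
      using adj_sandwich_cmat_span[OF S VTV, of V] sandwich_adj_cmat_span[OF T VSV, of V] by simp
  next
    case (Suc k)
    let ?P = "{x ** cmat_adj y ** z | x y z.
      x \<in> odd_products V k \<and> y \<in> odd_products V k \<and> z \<in> odd_products V k}"
    have "cmat_adj p ** t ** q \<in> S" if pq: "p \<in> ?P" "q \<in> ?P" and t: "t \<in> T" for p q t
    proof -
      obtain a b c where p: "p = a ** cmat_adj b ** c"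
        "a \<in> odd_products V k" "b \<in> odd_products V k" "c \<in> odd_products V k"
        using pq(1) by blast
      obtain a' b' c' where q: "q = a' ** cmat_adj b' ** c'"
        "a' \<in> odd_products V k" "b' \<in> odd_products V k" "c' \<in> odd_products V k"
        using pq(2) by blast
      have "cmat_adj p ** t ** q = cmat_adj c ** (b ** (cmat_adj a ** t ** a') ** cmat_adj b') ** c'"
        by (simp add: p(1) q(1) matrix_mul_assoc)
      then show ?thesis
        using Suc.IH p q t by simp
    qed
    moreover have "p ** s ** cmat_adj q \<in> T" if pq: "p \<in> ?P" "q \<in> ?P" and s: "s \<in> S" for p q s
    proof -
      obtain a b c where p: "p = a ** cmat_adj b ** c"
        "a \<in> odd_products V k" "b \<in> odd_products V k" "c \<in> odd_products V k"
        using pq(1) by blast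
      obtain a' b' c' where q: "q = a' ** cmat_adj b' ** c'"
        "a' \<in> odd_products V k" "b' \<in> odd_products V k" "c' \<in> odd_products V k"
        using pq(2) by blast
      have "p ** s ** cmat_adj q = a ** (cmat_adj b ** (c ** s ** cmat_adj c') ** b') ** cmat_adj a'"
        by (simp add: p(1) q(1) matrix_mul_assoc)
      then show ?thesis
        using Suc.IH p q s by simp
    qed
    ultimately show ?case
      using adj_sandwich_cmat_span[OF S, of ?P] sandwich_adj_cmat_span[OF T, of ?P] Suc.prems by simp
  qed
  then show "t \<in> T \<Longrightarrow> cmat_adj x ** t ** y \<in> S" "s \<in> S \<Longrightarrow> x ** s ** cmat_adj y \<in> T"
    by auto
qed

lemma TRO_equivalent_if_ucp:
  fixes S :: "(complex^'n^'n) set" and T :: "(complex^'m^'m) set"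
    and \<phi> :: "complex^'m^'m \<Rightarrow> complex^'n^'n"
  assumes "cmat.subspace S" "cmat.subspace T" "mat 1 \<in> T"
    and "ucp \<phi>" and ST: "S = pullback T \<phi>" "T = pushforward S \<phi>"
  shows "TRO_equivalent S T"
proof -
  define vs where "vs = kraus_ops \<phi>"
  have vs: "kraus_representation \<phi> vs"
    using assms(4) kraus_representation_exists kraus_ops_kraus_representation
    unfolding vs_def ucp_def by blast
  then have one: "(\<Sum>v\<leftarrow>vs. cmat_adj v ** v) = mat 1"
    using assms(4) unfolding ucp_def kraus_representation_def by (metis (no_types, lifting) matrix_mul_rid map_eq_conv)
  define M where "M = (\<Union>k. odd_products (set vs) k)"
  have "mono (odd_products (set vs))"
    by (rule mono_odd_products[OF one])
  then have M: "TRO M"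
    by (simp add: M_def TRO_UN_odd_products)
  have "set vs \<subseteq> odd_products (set vs) 0"
    by (simp add: cmat.span_superset)
  then have vsM: "set vs \<subseteq> M"
    unfolding M_def by blast
  have VTV: "cmat_adj v ** t ** w \<in> S" if "v \<in> set vs" "w \<in> set vs" "t \<in> T" for v w t
    using that by (subst ST(1)) (auto simp: pullback_def vs_def intro!: cmat.span_base)
  have VSV: "v ** s ** cmat_adj w \<in> T" if "v \<in> set vs" "w \<in> set vs" "s \<in> S" for v w s
    using that by (subst ST(2)) (auto simp: pushforward_def vs_def intro!: cmat.span_base)
  have "cmat_adj x ** t ** y \<in> S \<and> x ** s ** cmat_adj y \<in> T"
    if xy: "x \<in> M" "y \<in> M" and st: "s \<in> S" "t \<in> T" for x y s t
  proof -
    obtain i j where "x \<in> odd_products (set vs) i" "y \<in> odd_products (set vs) j"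
      using xy unfolding M_def by blast
    \<comment> \<open>Monotonicity moves both factors to a common level, where their lengths
      agree.\<close>
    then have ij: "x \<in> odd_products (set vs) (i + j)" "y \<in> odd_products (set vs) (i + j)"
      using monoD[OF \<open>mono (odd_products (set vs))\<close>, of i "i + j"]
        monoD[OF \<open>mono (odd_products (set vs))\<close>, of j "i + j"] by auto
    show ?thesis
      using sandwich_odd_products(1)[OF assms(1,2) VTV VSV ij st(2)]
        sandwich_odd_products(2)[OF assms(1,2) VTV VSV ij st(1)] by simp
  qed
  \<comment> \<open>The combined claim asks for an \<open>s\<close> and a \<open>t\<close> at once;
    the zero matrix serves as the one that does not occur.\<close>
  then have "\<forall>x\<in>M. \<forall>y\<in>M. \<forall>t\<in>T. cmat_adj x ** t ** y \<in> S" "\<forall>x\<in>M. \<forall>y\<in>M. \<forall>s\<in>S. x ** s ** cmat_adj y \<in> T"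
    using cmat.subspace_0[OF assms(1)] cmat.subspace_0[OF assms(2)] by blast+
  moreover have "nondegenerate M"
  proof -
    have "mat 1 \<in> cmat.span {cmat_adj x ** y | x y. x \<in> M \<and> y \<in> M}"
      unfolding one[symmetric] using vsM by (intro subspace_sum_list) (auto intro!: cmat.span_base)
    moreover have "mat 1 \<in> cmat.span {x ** cmat_adj y | x y. x \<in> M \<and> y \<in> M}"
    proof -
      let ?A = "cmat.span {x ** cmat_adj y | x y. x \<in> M \<and> y \<in> M}"
      have closed: "a ** b \<in> ?A" if "a \<in> ?A" "b \<in> ?A" for a b
      proof (rule mult_closed_cmat_span[OF _ that])
        fix a b assume "a \<in> {x ** cmat_adj y | x y. x \<in> M \<and> y \<in> M}" "b \<in> {x ** cmat_adj y | x y. x \<in> M \<and> y \<in> M}"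
        then obtain x y z w where xyzw: "a = x ** cmat_adj y" "b = z ** cmat_adj w" "x \<in> M" "y \<in> M" "z \<in> M" "w \<in> M"
          by blast
        then have "a ** b = (x ** cmat_adj y ** z) ** cmat_adj w" "x ** cmat_adj y ** z \<in> M"
          using M by (simp_all add: TRO_def matrix_mul_assoc)
        then show "a ** b \<in> ?A"
          using xyzw(6) by (blast intro: cmat.span_base)
      qed
      \<comment> \<open>The Gram matrix of the adjoints, that is, the sum of the
        \<open>v ** cmat_adj v\<close>.\<close>
      define d where "d = (\<Sum>v\<leftarrow>map cmat_adj vs. cmat_adj v ** v)"
      have "v ** cmat_adj v \<in> ?A" if "v \<in> set vs" for v
        using that vsM by (blast intro: cmat.span_base)
      then have "d \<in> ?A"
        unfolding d_def by (intro subspace_sum_list) auto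
      \<comment> \<open>If every \<open>cmat_adj v\<close> kills \<open>\<xi>\<close>, so does every
        generator of the pushforward, and hence the identity, which belongs to
        \<open>T\<close>.\<close>
      have "\<xi> = 0" if "d *v \<xi> = 0" for \<xi>
      proof -
        have "cmat_adj v *v \<xi> = 0" if "v \<in> set vs" for v
          using gram_matrix_kernel[of "map cmat_adj vs" \<xi>] that \<open>d *v \<xi> = 0\<close> by (auto simp: d_def)
        then have "a *v \<xi> = 0" if "a \<in> {v ** s ** cmat_adj w | v s w. s \<in> S \<and> v \<in> set vs \<and> w \<in> set vs}" for a
          using that by (auto simp: matrix_vector_mul_assoc[symmetric])
        moreover have "mat 1 \<in> cmat.span {v ** s ** cmat_adj w | v s w. s \<in> S \<and> v \<in> set vs \<and> w \<in> set vs}"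
          using assms(3) ST(2) unfolding pushforward_def vs_def by simp
        ultimately have "mat 1 *v \<xi> = 0"
          by (rule vanish_cmat_span)
        then show ?thesis
          by simp
      qed
      then obtain e where "e ** d = mat 1"
        using left_invertible_if_kernel_0 by blast
      then show ?thesis
        \<comment> \<open>The algebra is not assumed unital here: an element invertible among all
          matrices already forces the identity into it.\<close>
        using algebra_inverse(1)[OF _ closed \<open>d \<in> ?A\<close>] by simp
    qed
    ultimately show ?thesis
      by (simp add: nondegenerate_def)
  qed
  ultimately show ?thesis
    using M unfolding TRO_equivalent_def by blast
qed

theorem theoremC:
  fixes S :: "(complex^'n^'n) set" and T :: "(complex^'m^'m) set"
  assumes "nc_graph S" and "nc_graph T"
  shows "TRO_equivalent S T \<longleftrightarrow>
    (\<exists>\<phi> :: complex^'m^'m \<Rightarrow> complex^'n^'n. ucp \<phi> \<and> S = pullback T \<phi> \<and> T = pushforward S \<phi>)"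
  using assms ucp_if_TRO_equivalent TRO_equivalent_if_ucp unfolding nc_graph_def by blast

end
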